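(* Let $k\ge 1$, let $f_1,\dots,f_k$ be Möbius maps of $\widehat{\mathbb C}$, let $G=\langle f_1,\dots,f_k\rangle$ be the Möbius semigroup they generate, and let $b=(b_1,\dots,b_k)$ be a probability vector. Suppose $J_{\ker}(G^{-1})=\emptyset$ and $J(G^{-1})\neq\emptyset$. Then there is a Borel probability measure $\mu^b=\mu^b_G$ on $\widehat{\mathbb C}$ such that the measures $\mu_n^{a,b}$ converge weakly to $\mu^b$ as $n\to\infty$, independently of and uniformly in $a\in\widehat{\mathbb C}$ (i.e., for every $\phi\in C(\widehat{\mathbb C})$, $\int\phi\,d\mu_n^{a,b}\to\int\phi\,d\mu^b$ uniformly in $a\in\widehat{\mathbb C}$). Further, the support of $\mu^b$ is $J(G)$ and $T_b^*\mu^b=\mu^b$. Further, $\mu^b$ is the unique Borel probability measure on $\widehat{\mathbb C}$ satisfying $T_b^*\mu^b=\mu^b$.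
   Context: $\widehat{\mathbb C}$ is the Riemann sphere. A Möbius semigroup is a semigroup of Möbius maps of $\widehat{\mathbb C}$ under composition; $\langle f_1,\dots,f_k\rangle$ is the semigroup (not group) of all finite (nonempty) compositions of the $f_j$. The inverse semigroup is $G^{-1}=\{g^{-1}:g\in G\}=\langle f_1^{-1},\dots,f_k^{-1}\rangle$. For a Möbius semigroup $H$: the Fatou set $F(H)$ is the set of points of $\widehat{\mathbb C}$ having a neighborhood on which $H$ is a normal family (with respect to the spherical metric), the Julia set is $J(H)=\widehat{\mathbb C}\setminus F(H)$, and the kernel Julia set is $J_{\ker}(H)=\bigcap_{h\in H}h^{-1}(J(H))$. A probability vector $b=(b_1,\dots,b_k)$ has every $b_j>0$ and $\sum_j b_j=1$. With $\delta_z$ the unit point mass at $z$, define for $a\in\widehat{\mathbb C}$, $n\ge1$, $$\mu_n^{a,b}=\sum_{i_1,\dots,i_n=1}^k b_{i_1}\cdots b_{i_n}\,\delta_{f_{i_n}^{-1}\circ\cdots\circ f_{i_1}^{-1}(a)}.$$ The operator $T$ on the space $C(\widehat{\mathbb C})$ of continuous functions is $(T\phi)(z)=\sum_{j=1}^k b_j\,\phi(f_j^{-1}(z))$, and its adjoint $T_b^*$ acts on Borel probability measures by $\int\phi\,d(T_b^*\rho)=\int T\phi\,d\rho$, equivalently $(T_b^*\rho)(A)=\int\mu_1^{z,b}(A)\,d\rho(z)$ for Borel $A$. *)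

theory Defs
  imports "HOL-Probability.Probability"
begin

section \<open>The Riemann sphere\<close>

datatype riemann_sphere = Fin complex | Infty

text \<open>Inverse stereographic projection onto the unit sphere of \<open>\<complex> \<times> \<real>\<close>. The metric below is the
  chordal one; it is uniformly equivalent to the geodesic metric of the sphere.\<close>

fun stereo :: "riemann_sphere \<Rightarrow> complex \<times> real" where
  "stereo (Fin z) =
     ((2 / (1 + (cmod z)\<^sup>2)) *\<^sub>R z, ((cmod z)\<^sup>2 - 1) / ((cmod z)\<^sup>2 + 1))"
| "stereo Infty = (0, 1)"

lemma norm_sq_pos: "1 + (cmod z)\<^sup>2 > 0" "(cmod z)\<^sup>2 + 1 > 0" "1 + (cmod z)\<^sup>2 \<noteq> 0" "(cmod z)\<^sup>2 + 1 \<noteq> 0"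
  by (smt (verit) zero_le_power2)+

lemma dist_stereo_Fin_Fin:
  "dist (stereo (Fin z)) (stereo (Fin w)) =
     2 * cmod (z - w) / (sqrt (1 + (cmod z)\<^sup>2) * sqrt (1 + (cmod w)\<^sup>2))"
proof -
  define A where "A = 1 + (cmod z)\<^sup>2"
  define B where "B = 1 + (cmod w)\<^sup>2"
  have pos: "A > 0" "B > 0" using norm_sq_pos unfolding A_def B_def by auto
  have A: "A = 1 + (Re z)\<^sup>2 + (Im z)\<^sup>2" and B: "B = 1 + (Re w)\<^sup>2 + (Im w)\<^sup>2"
    by (simp_all add: A_def B_def cmod_power2)
  have e: "((cmod z)\<^sup>2 - 1) / ((cmod z)\<^sup>2 + 1) = 1 - 2 / A"
          "((cmod w)\<^sup>2 - 1) / ((cmod w)\<^sup>2 + 1) = 1 - 2 / B"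
    using norm_sq_pos[of z] norm_sq_pos[of w] by (simp_all add: A_def B_def field_simps)
  have "(dist (stereo (Fin z)) (stereo (Fin w)))\<^sup>2 =
      (2 / A * Re z - 2 / B * Re w)\<^sup>2 + (2 / A * Im z - 2 / B * Im w)\<^sup>2 + (2 / B - 2 / A)\<^sup>2"
    by (simp add: dist_Pair_Pair e flip: A_def B_def)
       (simp add: dist_norm cmod_power2 dist_real_def)
  also have "\<dots> = 4 / A\<^sup>2 * (1 + (Re z)\<^sup>2 + (Im z)\<^sup>2) + 4 / B\<^sup>2 * (1 + (Re w)\<^sup>2 + (Im w)\<^sup>2)
      - 8 / (A * B) * (1 + Re z * Re w + Im z * Im w)"
    using pos by (simp add: field_simps power2_eq_square)
  also have "\<dots> = 4 / A + 4 / B - 8 / (A * B) * (1 + Re z * Re w + Im z * Im w)"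
    unfolding A[symmetric] B[symmetric] using pos by (simp add: power2_eq_square)
  also have "\<dots> = 4 * (A + B - 2 * (1 + Re z * Re w + Im z * Im w)) / (A * B)"
    using pos by (simp add: field_simps)
  also have "A + B - 2 * (1 + Re z * Re w + Im z * Im w) = (cmod (z - w))\<^sup>2"
    unfolding A B cmod_power2 by (simp add: power2_eq_square algebra_simps)
  also have "4 * (cmod (z - w))\<^sup>2 / (A * B) = (2 * cmod (z - w) / (sqrt A * sqrt B))\<^sup>2"
    using pos by (simp add: power_divide power_mult_distrib)
  finally show ?thesis
    unfolding A_def B_def by (rule power2_eq_imp_eq) (auto intro!: divide_nonneg_nonneg)
qed

lemma dist_stereo_Fin_Infty: "dist (stereo (Fin z)) (stereo Infty) = 2 / sqrt (1 + (cmod z)\<^sup>2)"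
proof -
  define A where "A = 1 + (cmod z)\<^sup>2"
  have pos: "A > 0" using norm_sq_pos unfolding A_def by auto
  have A: "A = 1 + (Re z)\<^sup>2 + (Im z)\<^sup>2"
    by (simp add: A_def cmod_power2)
  have e: "((cmod z)\<^sup>2 - 1) / ((cmod z)\<^sup>2 + 1) = 1 - 2 / A"
    using norm_sq_pos[of z] by (simp add: A_def field_simps)
  have "(dist (stereo (Fin z)) (stereo Infty))\<^sup>2 = (2 / A * Re z)\<^sup>2 + (2 / A * Im z)\<^sup>2 + (2 / A)\<^sup>2"
    by (simp add: dist_Pair_Pair e flip: A_def)
       (simp add: dist_norm dist_real_def power_mult_distrib power_divide cmod_power2
          distrib_left add_divide_distrib)
  also have "\<dots> = 4 / A\<^sup>2 * (1 + (Re z)\<^sup>2 + (Im z)\<^sup>2)"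
    using pos by (simp add: field_simps power2_eq_square)
  also have "\<dots> = (2 / sqrt A)\<^sup>2"
    unfolding A[symmetric] using pos by (simp add: power2_eq_square)
  finally show ?thesis
    unfolding A_def by (rule power2_eq_imp_eq) (auto intro!: divide_nonneg_nonneg)
qed

lemma stereo_eq_iff: "stereo p = stereo q \<longleftrightarrow> p = q"
proof
  assume eq: "stereo p = stereo q"
  then have d: "dist (stereo p) (stereo q) = 0" by simp
  have pos: "sqrt (1 + (cmod z)\<^sup>2) \<noteq> 0" for z using norm_sq_pos by simp
  show "p = q"
  proof (cases p; cases q)
    fix z w assume "p = Fin z" "q = Fin w"
    with d pos show ?thesis by (simp add: dist_stereo_Fin_Fin del: stereo.simps real_sqrt_eq_0_iff)
  next
    fix z assume "p = Fin z" "q = Infty"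
    with d pos show ?thesis by (simp add: dist_stereo_Fin_Infty del: stereo.simps real_sqrt_eq_0_iff)
  next
    fix z assume "p = Infty" "q = Fin z"
    with d pos show ?thesis
      by (simp add: dist_stereo_Fin_Infty dist_commute[of "stereo Infty"]
               del: stereo.simps real_sqrt_eq_0_iff)
  qed auto
qed simp

instantiation riemann_sphere :: metric_space
begin

definition dist_riemann_sphere :: "riemann_sphere \<Rightarrow> riemann_sphere \<Rightarrow> real" where
  "dist_riemann_sphere p q = dist (stereo p) (stereo q)"

definition uniformity_riemann_sphere :: "(riemann_sphere \<times> riemann_sphere) filter" where
  "uniformity_riemann_sphere = (INF e\<in>{0 <..}. principal {(x, y). dist x y < e})"

definition open_riemann_sphere :: "riemann_sphere set \<Rightarrow> bool" where
  "open_riemann_sphere U \<longleftrightarrow> (\<forall>x\<in>U. \<forall>\<^sub>F (x', y) in uniformity. x' = x \<longrightarrow> y \<in> U)"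

instance
proof
  fix p q r :: riemann_sphere
  show "dist p q = 0 \<longleftrightarrow> p = q"
    by (simp add: dist_riemann_sphere_def stereo_eq_iff)
  show "dist p q \<le> dist p r + dist q r"
    unfolding dist_riemann_sphere_def by (rule dist_triangle2)
qed (simp_all add: uniformity_riemann_sphere_def open_riemann_sphere_def)

end

lemma dist_Fin_Fin:
  "dist (Fin z) (Fin w) = 2 * cmod (z - w) / (sqrt (1 + (cmod z)\<^sup>2) * sqrt (1 + (cmod w)\<^sup>2))"
  unfolding dist_riemann_sphere_def by (rule dist_stereo_Fin_Fin)

lemma dist_Fin_Infty: "dist (Fin z) Infty = 2 / sqrt (1 + (cmod z)\<^sup>2)"
  unfolding dist_riemann_sphere_def by (rule dist_stereo_Fin_Infty)


section \<open>Moebius maps\<close>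

fun moebius :: "complex \<Rightarrow> complex \<Rightarrow> complex \<Rightarrow> complex \<Rightarrow> riemann_sphere \<Rightarrow> riemann_sphere" where
  "moebius a b c d (Fin z) = (if c * z + d = 0 then Infty else Fin ((a * z + b) / (c * z + d)))"
| "moebius a b c d Infty = (if c = 0 then Infty else Fin (a / c))"

definition is_moebius :: "(riemann_sphere \<Rightarrow> riemann_sphere) \<Rightarrow> bool" where
  "is_moebius f \<longleftrightarrow> (\<exists>a b c d. a * d - b * c \<noteq> 0 \<and> f = moebius a b c d)"

text \<open>The point with homogeneous coordinates \<open>[x : y]\<close>.\<close>

definition hpoint :: "complex \<Rightarrow> complex \<Rightarrow> riemann_sphere" where
  "hpoint x y = (if y = 0 then Infty else Fin (x / y))"

lemma hpoint_cases: obtains x y where "p = hpoint x y" "(x, y) \<noteq> 0"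
proof (cases p)
  case (Fin z)
  then show ?thesis using that[of z 1] by (auto simp: hpoint_def zero_prod_def)
next
  case Infty
  then show ?thesis using that[of 1 0] by (auto simp: hpoint_def zero_prod_def)
qed

lemma hpoint_scale: "t \<noteq> 0 \<Longrightarrow> hpoint (t * x) (t * y) = hpoint x y"
  by (simp add: hpoint_def)

lemma moebius_hpoint:
  assumes "(x, y) \<noteq> 0"
  shows "moebius a b c d (hpoint x y) = hpoint (a * x + b * y) (c * x + d * y)"
proof (cases "y = 0")
  case True
  then show ?thesis using assms by (auto simp: hpoint_def zero_prod_def)
next
  case False
  have "a * (x / y) + b = (a * x + b * y) / y" "c * (x / y) + d = (c * x + d * y) / y"
    using False by (simp_all add: field_simps)
  then show ?thesis using False by (simp add: hpoint_def)
qed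

lemma matrix_inverse_apply:
  fixes a b c d x y :: complex
  shows "d * (a * x + b * y) + (- b) * (c * x + d * y) = (a * d - b * c) * x"
    and "(- c) * (a * x + b * y) + a * (c * x + d * y) = (a * d - b * c) * y"
  by (simp_all add: algebra_simps)

lemma matrix_apply_nonzero:
  fixes a b c d x y :: complex
  assumes "a * d - b * c \<noteq> 0" "(x, y) \<noteq> 0"
  shows "(a * x + b * y, c * x + d * y) \<noteq> 0"
proof
  assume "(a * x + b * y, c * x + d * y) = 0"
  then have "a * x + b * y = 0" "c * x + d * y = 0" by (simp_all add: zero_prod_def)
  then have "(a * d - b * c) * x = 0" "(a * d - b * c) * y = 0"
    using matrix_inverse_apply(1)[of d a x b y c] matrix_inverse_apply(2)[of c a x b y d]
    by simp_all
  then show False using assms by (simp add: zero_prod_def)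
qed

lemma moebius_inverse_left:
  assumes "a * d - b * c \<noteq> 0"
  shows "moebius d (- b) (- c) a (moebius a b c d p) = p"
proof -
  obtain x y where p: "p = hpoint x y" "(x, y) \<noteq> 0" by (rule hpoint_cases)
  show ?thesis
    unfolding p(1) moebius_hpoint[OF p(2)] moebius_hpoint[OF matrix_apply_nonzero[OF assms p(2)]]
      matrix_inverse_apply
    by (rule hpoint_scale[OF assms])
qed

lemma moebius_inverse_right:
  assumes "a * d - b * c \<noteq> 0"
  shows "moebius a b c d (moebius d (- b) (- c) a p) = p"
  using moebius_inverse_left[of d a "- b" "- c" p] assms by (simp add: mult.commute)

lemma bij_moebius: "is_moebius f \<Longrightarrow> bij f"
  unfolding is_moebius_def
  by (metis moebius_inverse_left moebius_inverse_right bijI')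

lemma inv_moebius:
  "a * d - b * c \<noteq> 0 \<Longrightarrow> inv (moebius a b c d) = moebius d (- b) (- c) a"
  by (intro inv_equality moebius_inverse_left moebius_inverse_right)

lemma is_moebius_inv:
  assumes "is_moebius f"
  shows "is_moebius (inv f)"
proof -
  obtain a b c d where "a * d - b * c \<noteq> 0" "f = moebius a b c d"
    using assms unfolding is_moebius_def by blast
  then show ?thesis
    unfolding is_moebius_def
    by (intro exI[of _ d] exI[of _ "- b"] exI[of _ "- c"] exI[of _ a])
       (simp add: inv_moebius mult.commute)
qed

lemma dist_hpoint:
  assumes "(x, y) \<noteq> 0" "(u, v) \<noteq> 0"
  shows "dist (hpoint x y) (hpoint u v) = 2 * cmod (x * v - y * u) / (norm (x, y) * norm (u, v))"
proof -
  have n: "norm (s, t) = cmod t * sqrt (1 + (cmod (s / t))\<^sup>2)" if "t \<noteq> 0" for s t :: complex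
  proof -
    have "cmod t * sqrt (1 + (cmod (s / t))\<^sup>2) = sqrt ((cmod t)\<^sup>2 * (1 + (cmod (s / t))\<^sup>2))"
      by (simp add: real_sqrt_mult)
    also have "(cmod t)\<^sup>2 * (1 + (cmod (s / t))\<^sup>2) = (cmod s)\<^sup>2 + (cmod t)\<^sup>2"
      using that by (simp add: norm_divide field_simps)
    finally show ?thesis by (simp add: norm_Pair)
  qed
  have s: "sqrt (1 + (cmod z)\<^sup>2) \<noteq> 0" for z using norm_sq_pos by simp
  have inf: "dist (hpoint s t) Infty = 2 * cmod t / norm (s, t)" if "t \<noteq> 0" for s t
    using that s by (simp add: n hpoint_def dist_Fin_Infty)
  consider "y = 0" "v = 0" | "y = 0" "v \<noteq> 0" | "y \<noteq> 0" "v = 0" | "y \<noteq> 0" "v \<noteq> 0" by blast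
  then show ?thesis
  proof cases
    case 1 then show ?thesis by (simp add: hpoint_def)
  next
    case 2
    then have "x \<noteq> 0" using assms by (auto simp: zero_prod_def)
    with 2 inf[OF 2(2), of u] show ?thesis
      by (simp add: hpoint_def dist_commute[of Infty] norm_mult)
  next
    case 3
    then have "u \<noteq> 0" using assms by (auto simp: zero_prod_def)
    with 3 inf[OF 3(1), of x] show ?thesis
      by (simp add: hpoint_def norm_mult)
  next
    case 4
    have "x * v - y * u = (x / y - u / v) * (y * v)" using 4 by (simp add: field_simps)
    then have "cmod (x * v - y * u) = cmod (x / y - u / v) * (cmod y * cmod v)"
      by (simp only: norm_mult)
    then show ?thesis using 4
      by (simp add: n[OF 4(1)] n[OF 4(2)] hpoint_def dist_Fin_Fin del: diff_divide_distrib)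
  qed
qed

lemma norm_matrix_apply_le:
  fixes a b c d x y :: complex
  shows "norm (a * x + b * y, c * x + d * y) \<le> (cmod a + cmod b + cmod c + cmod d) * norm (x, y)"
proof -
  have x: "cmod x \<le> norm (x, y)" and y: "cmod y \<le> norm (x, y)"
    using norm_fst_le[of x y] norm_snd_le[of y x] by auto
  have "norm (a * x + b * y, c * x + d * y) \<le> cmod (a * x + b * y) + cmod (c * x + d * y)"
    by (rule norm_Pair_le)
  also have "\<dots> \<le> (cmod a * cmod x + cmod b * cmod y) + (cmod c * cmod x + cmod d * cmod y)"
    by (intro add_mono order.trans[OF norm_triangle_ineq]) (simp_all add: norm_mult)
  also have "\<dots> \<le> (cmod a * norm (x, y) + cmod b * norm (x, y))
      + (cmod c * norm (x, y) + cmod d * norm (x, y))"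
    by (intro add_mono mult_left_mono x y) auto
  finally show ?thesis by (simp add: algebra_simps)
qed

lemma moebius_lipschitz:
  assumes "is_moebius f"
  shows "\<exists>L. \<forall>p q. dist (f p) (f q) \<le> L * dist p q"
proof -
  obtain a b c d where det: "a * d - b * c \<noteq> 0" and f: "f = moebius a b c d"
    using assms unfolding is_moebius_def by blast
  define D where "D = cmod (a * d - b * c)"
  define M where "M = cmod d + cmod (- b) + cmod (- c) + cmod a"
  have D: "D > 0" using det by (simp add: D_def)
  have low: "D * norm (x, y) \<le> M * norm (a * x + b * y, c * x + d * y)" for x y
  proof -
    have "norm ((a * d - b * c) * x, (a * d - b * c) * y) = D * norm (x, y)"
      by (simp add: norm_Pair D_def norm_mult power_mult_distrib real_sqrt_mult
               flip: distrib_left)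
    then show ?thesis
      using norm_matrix_apply_le[of d "a * x + b * y" "- b" "c * x + d * y" "- c" a]
      unfolding matrix_inverse_apply M_def by simp
  qed
  have "dist (f p) (f q) \<le> (M\<^sup>2 / D) * dist p q" for p q
  proof -
    obtain x y where p: "p = hpoint x y" "(x, y) \<noteq> 0" by (rule hpoint_cases)
    obtain u v where q: "q = hpoint u v" "(u, v) \<noteq> 0" by (rule hpoint_cases)
    define P where "P = norm (a * x + b * y, c * x + d * y)"
    define Q where "Q = norm (a * u + b * v, c * u + d * v)"
    define P0 where "P0 = norm (x, y)"
    define Q0 where "Q0 = norm (u, v)"
    define C where "C = cmod (x * v - y * u)"
    have pos: "P > 0" "Q > 0" "P0 > 0" "Q0 > 0"
      using matrix_apply_nonzero[OF det p(2)] matrix_apply_nonzero[OF det q(2)] p(2) q(2)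
      unfolding P_def Q_def P0_def Q0_def by (simp_all only: zero_less_norm_iff not_False_eq_True)
    have "(a * x + b * y) * (c * u + d * v) - (c * x + d * y) * (a * u + b * v)
        = (a * d - b * c) * (x * v - y * u)"
      by (simp add: algebra_simps)
    then have e: "dist (f p) (f q) = 2 * (D * C) / (P * Q)"
      unfolding f p(1) q(1) moebius_hpoint[OF p(2)] moebius_hpoint[OF q(2)]
        dist_hpoint[OF matrix_apply_nonzero[OF det p(2)] matrix_apply_nonzero[OF det q(2)]]
        P_def Q_def D_def C_def by (simp only: norm_mult)
    have e0: "dist p q = 2 * C / (P0 * Q0)"
      unfolding p(1) q(1) dist_hpoint[OF p(2) q(2)] C_def P0_def Q0_def ..
    have "(D * P0) * (D * Q0) \<le> (M * P) * (M * Q)"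
      unfolding P_def Q_def P0_def Q0_def
      by (rule mult_mono[OF low low]) (simp_all add: M_def D_def)
    then have "(2 * C) * ((D * P0) * (D * Q0)) \<le> (2 * C) * ((M * P) * (M * Q))"
      by (rule mult_left_mono) (simp add: C_def)
    then show ?thesis
      unfolding e e0 using pos D by (simp add: field_simps power2_eq_square)
  qed
  then show ?thesis by blast
qed

lemma continuous_on_moebius:
  assumes "is_moebius f"
  shows "continuous_on S f"
proof -
  obtain L where L: "\<And>p q. dist (f p) (f q) \<le> L * dist p q"
    using moebius_lipschitz[OF assms] by blast
  have "dist (f p) (f q) \<le> max L 0 * dist p q" for p q
    using L[of p q] by (smt (verit) mult_right_mono zero_le_dist)
  then have "(max L 0)-lipschitz_on S f" by (intro lipschitz_onI) auto
  then show ?thesis by (rule lipschitz_on_continuous_on)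
qed


section \<open>Moebius semigroups, Fatou and Julia sets\<close>

inductive_set generated_semigroup :: "('a \<Rightarrow> 'a) set \<Rightarrow> ('a \<Rightarrow> 'a) set" for S where
  generator: "g \<in> S \<Longrightarrow> g \<in> generated_semigroup S"
| comp: "g \<in> generated_semigroup S \<Longrightarrow> h \<in> generated_semigroup S
           \<Longrightarrow> g \<circ> h \<in> generated_semigroup S"

definition inverse_semigroup :: "('a \<Rightarrow> 'a) set \<Rightarrow> ('a \<Rightarrow> 'a) set" where
  "inverse_semigroup H = inv ` H"

definition normal_family_on :: "riemann_sphere set \<Rightarrow> (riemann_sphere \<Rightarrow> riemann_sphere) set \<Rightarrow> bool"
  where
  "normal_family_on U H \<longleftrightarrow>
     (\<forall>h :: nat \<Rightarrow> riemann_sphere \<Rightarrow> riemann_sphere. range h \<subseteq> H \<longrightarrow>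
       (\<exists>r l. strict_mono r \<and>
         (\<forall>K. compact K \<and> K \<subseteq> U \<longrightarrow> uniform_limit K (\<lambda>n. h (r n)) l sequentially)))"

definition fatou :: "(riemann_sphere \<Rightarrow> riemann_sphere) set \<Rightarrow> riemann_sphere set" where
  "fatou H = {z. \<exists>U. open U \<and> z \<in> U \<and> normal_family_on U H}"

definition julia :: "(riemann_sphere \<Rightarrow> riemann_sphere) set \<Rightarrow> riemann_sphere set" where
  "julia H = - fatou H"

definition kernel_julia :: "(riemann_sphere \<Rightarrow> riemann_sphere) set \<Rightarrow> riemann_sphere set" where
  "kernel_julia H = (\<Inter>h\<in>H. h -` julia H)"


section \<open>The measures and the transition operator\<close>

definition borel_probability :: "'a::topological_space measure \<Rightarrow> bool" where
  "borel_probability \<mu> \<longleftrightarrow> prob_space \<mu> \<and> sets \<mu> = sets borel"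

definition measure_support :: "'a::topological_space measure \<Rightarrow> 'a set" where
  "measure_support \<mu> = {z. \<forall>U. open U \<and> z \<in> U \<longrightarrow> emeasure \<mu> U > 0}"

definition words :: "nat \<Rightarrow> nat \<Rightarrow> nat list set" where
  "words k n = {w. length w = n \<and> set w \<subseteq> {1..k}}"

text \<open>For \<open>w = [i\<^sub>1, \<dots>, i\<^sub>n]\<close> the inverse of \<open>f i\<^sub>1\<close> is applied first.\<close>

definition backward_image :: "(nat \<Rightarrow> 'a \<Rightarrow> 'a) \<Rightarrow> nat list \<Rightarrow> 'a \<Rightarrow> 'a" where
  "backward_image f w a = fold (\<lambda>i. inv (f i)) w a"

definition backward_measure ::
  "nat \<Rightarrow> (nat \<Rightarrow> 'a \<Rightarrow> 'a) \<Rightarrow> (nat \<Rightarrow> real) \<Rightarrow> nat \<Rightarrow> 'a \<Rightarrow> 'a::topological_space measure" where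
  "backward_measure k f b n a =
     measure_of UNIV (sets borel)
       (\<lambda>A. \<Sum>w\<in>words k n. ennreal (prod_list (map b w)) *
              emeasure (return borel (backward_image f w a)) A)"

definition transition_op ::
  "nat \<Rightarrow> (nat \<Rightarrow> 'a \<Rightarrow> 'a) \<Rightarrow> (nat \<Rightarrow> real) \<Rightarrow> ('a \<Rightarrow> real) \<Rightarrow> 'a \<Rightarrow> real" where
  "transition_op k f b \<phi> z = (\<Sum>j=1..k. b j * \<phi> (inv (f j) z))"

definition adjoint_op ::
  "nat \<Rightarrow> (nat \<Rightarrow> 'a \<Rightarrow> 'a) \<Rightarrow> (nat \<Rightarrow> real) \<Rightarrow> 'a::topological_space measure \<Rightarrow> 'a measure" where
  "adjoint_op k f b \<rho> =
     measure_of UNIV (sets borel) (\<lambda>A. \<integral>\<^sup>+z. emeasure (backward_measure k f b 1 z) A \<partial>\<rho>)"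

lemma finite_words: "finite (words k n)"
  unfolding words_def using finite_lists_length_eq[of "{1..k}" n] by (simp add: conj_commute)

lemma words_1: "words k 1 = (\<lambda>j. [j]) ` {1..k}"
  by (auto simp: words_def length_Suc_conv)

lemma sets_backward_measure [simp]: "sets (backward_measure k f b n a) = sets borel"
  unfolding backward_measure_def using sets.sigma_sets_eq[of borel] by (simp add: sets_measure_of)

lemma space_backward_measure [simp]: "space (backward_measure k f b n a) = UNIV"
  unfolding backward_measure_def by (simp add: space_measure_of_conv)

lemma sets_adjoint_op [simp]: "sets (adjoint_op k f b \<rho>) = sets borel"
  unfolding adjoint_op_def using sets.sigma_sets_eq[of borel] by (simp add: sets_measure_of)

lemma space_adjoint_op [simp]: "space (adjoint_op k f b \<rho>) = UNIV"
  unfolding adjoint_op_def by (simp add: space_measure_of_conv)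

lemma emeasure_backward_measure:
  assumes "A \<in> sets borel"
  shows "emeasure (backward_measure k f b n a) A =
    (\<Sum>w\<in>words k n. ennreal (prod_list (map b w)) *
       emeasure (return borel (backward_image f w a)) A)"
proof (rule emeasure_measure_of[OF backward_measure_def])
  show "countably_additive (sets (backward_measure k f b n a))
     (\<lambda>A. \<Sum>w\<in>words k n. ennreal (prod_list (map b w)) *
       emeasure (return borel (backward_image f w a)) A)"
  proof (rule countably_additiveI)
    fix X :: "nat \<Rightarrow> 'a set"
    assume X: "range X \<subseteq> sets (backward_measure k f b n a)" "disjoint_family X"
    have "(\<Sum>i. emeasure (return borel (backward_image f w a)) (X i)) =
        emeasure (return borel (backward_image f w a)) (\<Union> (range X))" for w
      by (rule suminf_emeasure) (use X in auto)
    then show "(\<Sum>i. \<Sum>w\<in>words k n. ennreal (prod_list (map b w)) *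
        emeasure (return borel (backward_image f w a)) (X i)) =
      (\<Sum>w\<in>words k n. ennreal (prod_list (map b w)) *
        emeasure (return borel (backward_image f w a)) (\<Union> (range X)))"
      by (subst suminf_sum) (simp_all add: ennreal_suminf_cmult)
  qed
qed (use assms in \<open>auto simp: positive_def\<close>)

lemma emeasure_backward_measure_1:
  assumes "A \<in> sets borel"
  shows "emeasure (backward_measure k f b 1 z) A = (\<Sum>j=1..k. ennreal (b j) * indicator A (inv (f j) z))"
  unfolding emeasure_backward_measure[OF assms] words_1
  using assms by (subst sum.reindex) (auto simp: inj_on_def backward_image_def)

lemma emeasure_adjoint_op:
  assumes f: "\<And>j. j \<in> {1..k} \<Longrightarrow> is_moebius (f j)" and \<rho>: "sets \<rho> = sets borel"
    and A: "A \<in> sets borel"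
  shows "emeasure (adjoint_op k f b \<rho>) A = (\<integral>\<^sup>+z. emeasure (backward_measure k f b 1 z) A \<partial>\<rho>)"
proof (rule emeasure_measure_of[OF adjoint_op_def])
  have [measurable]: "inv (f j) \<in> borel_measurable \<rho>" if "j \<in> {1..k}" for j
    using borel_measurable_continuous_onI[OF continuous_on_moebius[OF is_moebius_inv[OF f[OF that]]]]
    by (simp add: measurable_cong_sets[OF \<rho> refl])
  have m: "(\<lambda>z. emeasure (backward_measure k f b 1 z) B) \<in> borel_measurable \<rho>" if "B \<in> sets borel" for B
    unfolding emeasure_backward_measure_1[OF that]
    by (intro borel_measurable_sum borel_measurable_times_ennreal borel_measurable_const
        measurable_compose[OF _ borel_measurable_indicator[OF that]]) measurable
  show "countably_additive (sets (adjoint_op k f b \<rho>))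
     (\<lambda>A. \<integral>\<^sup>+z. emeasure (backward_measure k f b 1 z) A \<partial>\<rho>)"
  proof (rule countably_additiveI)
    fix X :: "nat \<Rightarrow> riemann_sphere set"
    assume X: "range X \<subseteq> sets (adjoint_op k f b \<rho>)" "disjoint_family X"
    have "(\<Sum>i. \<integral>\<^sup>+z. emeasure (backward_measure k f b 1 z) (X i) \<partial>\<rho>) =
        (\<integral>\<^sup>+z. (\<Sum>i. emeasure (backward_measure k f b 1 z) (X i)) \<partial>\<rho>)"
      by (rule nn_integral_suminf[symmetric], rule m) (use X in auto)
    also have "\<dots> = (\<integral>\<^sup>+z. emeasure (backward_measure k f b 1 z) (\<Union> (range X)) \<partial>\<rho>)"
      by (intro nn_integral_cong suminf_emeasure) (use X in auto)
    finally show "(\<Sum>i. \<integral>\<^sup>+z. emeasure (backward_measure k f b 1 z) (X i) \<partial>\<rho>) =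
        (\<integral>\<^sup>+z. emeasure (backward_measure k f b 1 z) (\<Union> (range X)) \<partial>\<rho>)" .
  qed
qed (use A in \<open>auto simp: positive_def\<close>)

lemma nn_integral_adjoint_op:
  assumes f: "\<And>j. j \<in> {1..k} \<Longrightarrow> is_moebius (f j)" and \<rho>: "sets \<rho> = sets borel"
    and g: "g \<in> borel_measurable borel"
  shows "(\<integral>\<^sup>+z. g z \<partial>adjoint_op k f b \<rho>) = (\<integral>\<^sup>+z. (\<Sum>j=1..k. ennreal (b j) * g (inv (f j) z)) \<partial>\<rho>)"
proof -
  have inv[measurable]: "inv (f j) \<in> borel_measurable \<rho>" if "j \<in> {1..k}" for j
    using borel_measurable_continuous_onI[OF continuous_on_moebius[OF is_moebius_inv[OF f[OF that]]]]
    by (simp add: measurable_cong_sets[OF \<rho> refl])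
  have comp: "(\<lambda>z. ennreal (b j) * g (inv (f j) z)) \<in> borel_measurable \<rho>"
    if "j \<in> {1..k}" "g \<in> borel_measurable borel" for j g
    by (intro borel_measurable_times_ennreal borel_measurable_const measurable_compose[OF inv])
       (use that in auto)
  have meas: "borel_measurable (adjoint_op k f b \<rho>) = borel_measurable borel"
    by (rule measurable_cong_sets) auto
  show ?thesis
    using g
  proof (induction rule: borel_measurable_induct)
    case (cong g h)
    then show ?case by (simp add: fun_eq_iff)
  next
    case (set A)
    have "emeasure (adjoint_op k f b \<rho>) A = (\<integral>\<^sup>+z. emeasure (backward_measure k f b 1 z) A \<partial>\<rho>)"
      by (intro emeasure_adjoint_op f \<rho> set)
    then show ?case
      unfolding emeasure_backward_measure_1[OF set, symmetric]
      using nn_integral_indicator[of A "adjoint_op k f b \<rho>"] set by simp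
  next
    case (mult u c)
    have "(\<integral>\<^sup>+z. c * u z \<partial>adjoint_op k f b \<rho>) = c * (\<integral>\<^sup>+z. u z \<partial>adjoint_op k f b \<rho>)"
      using mult by (intro nn_integral_cmult) (simp add: meas)
    also have "\<dots> = (\<integral>\<^sup>+z. c * (\<Sum>j=1..k. ennreal (b j) * u (inv (f j) z)) \<partial>\<rho>)"
      unfolding mult.IH using mult
      by (intro nn_integral_cmult[symmetric] borel_measurable_sum comp) auto
    finally show ?case by (simp add: sum_distrib_left mult_ac)
  next
    case (add u v)
    have "(\<integral>\<^sup>+z. v z + u z \<partial>adjoint_op k f b \<rho>) =
        (\<integral>\<^sup>+z. v z \<partial>adjoint_op k f b \<rho>) + (\<integral>\<^sup>+z. u z \<partial>adjoint_op k f b \<rho>)"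
      using add by (intro nn_integral_add) (simp_all add: meas)
    also have "\<dots> = (\<integral>\<^sup>+z. (\<Sum>j=1..k. ennreal (b j) * v (inv (f j) z)) +
        (\<Sum>j=1..k. ennreal (b j) * u (inv (f j) z)) \<partial>\<rho>)"
      unfolding add.IH using add
      by (intro nn_integral_add[symmetric] borel_measurable_sum comp) auto
    finally show ?case by (simp add: sum.distrib distrib_left)
  next
    case (seq U)
    have SUP_eq: "(SUP i. U i) z = (SUP i. U i z)" for z by (simp add: image_comp)
    have "(\<integral>\<^sup>+z. (SUP i. U i z) \<partial>adjoint_op k f b \<rho>) = (SUP i. \<integral>\<^sup>+z. U i z \<partial>adjoint_op k f b \<rho>)"
      using seq by (intro nn_integral_monotone_convergence_SUP) (simp_all add: meas)
    also have "\<dots> = (SUP i. \<integral>\<^sup>+z. (\<Sum>j=1..k. ennreal (b j) * U i (inv (f j) z)) \<partial>\<rho>)"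
      using seq.IH by simp
    also have "\<dots> = (\<integral>\<^sup>+z. (SUP i. \<Sum>j=1..k. ennreal (b j) * U i (inv (f j) z)) \<partial>\<rho>)"
      using seq
      by (intro nn_integral_monotone_convergence_SUP[symmetric] borel_measurable_sum comp)
         (auto simp: incseq_def le_fun_def intro!: sum_mono mult_left_mono)
    also have "(\<lambda>z. SUP i. \<Sum>j=1..k. ennreal (b j) * U i (inv (f j) z)) =
        (\<lambda>z. \<Sum>j=1..k. ennreal (b j) * (SUP i. U i (inv (f j) z)))"
    proof
      fix z
      have "(SUP i. \<Sum>j=1..k. ennreal (b j) * U i (inv (f j) z)) =
          (\<Sum>j=1..k. SUP i. ennreal (b j) * U i (inv (f j) z))"
        using seq by (intro ennreal_SUP_sum)
           (auto simp: incseq_def le_fun_def intro!: mult_left_mono)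
      then show "(SUP i. \<Sum>j=1..k. ennreal (b j) * U i (inv (f j) z)) =
          (\<Sum>j=1..k. ennreal (b j) * (SUP i. U i (inv (f j) z)))"
        by (simp add: SUP_mult_left_ennreal)
    qed
    finally show ?case by (simp add: image_comp)
  qed
qed

text \<open>The kernel description of \<open>adjoint_op\<close> agrees with the one by duality with \<open>transition_op\<close>.\<close>

lemma integral_adjoint_op:
  fixes \<phi> :: "riemann_sphere \<Rightarrow> real"
  assumes f: "\<And>j. j \<in> {1..k} \<Longrightarrow> is_moebius (f j)" and b: "\<And>j. j \<in> {1..k} \<Longrightarrow> b j \<ge> 0"
    and \<rho>: "borel_probability \<rho>"
    and \<phi>: "\<phi> \<in> borel_measurable borel" and C: "\<And>z. \<bar>\<phi> z\<bar> \<le> C"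
  shows "(\<integral>z. \<phi> z \<partial>adjoint_op k f b \<rho>) = (\<integral>z. transition_op k f b \<phi> z \<partial>\<rho>)"
proof -
  interpret prob_space \<rho> using \<rho> by (simp add: borel_probability_def)
  have sets: "sets \<rho> = sets borel" using \<rho> by (simp add: borel_probability_def)
  have inv: "inv (f j) \<in> borel_measurable \<rho>" if "j \<in> {1..k}" for j
    using borel_measurable_continuous_onI[OF continuous_on_moebius[OF is_moebius_inv[OF f[OF that]]]]
    by (simp add: measurable_cong_sets[OF sets refl])
  have meas: "borel_measurable (adjoint_op k f b \<rho>) = borel_measurable borel"
    by (rule measurable_cong_sets) auto
  have T_meas: "transition_op k f b \<psi> \<in> borel_measurable \<rho>" if "\<psi> \<in> borel_measurable borel" for \<psi>
    unfolding transition_op_def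
    by (intro borel_measurable_sum borel_measurable_times borel_measurable_const
        measurable_compose[OF inv that]) auto
  have "emeasure (adjoint_op k f b \<rho>) UNIV = (\<integral>\<^sup>+z. emeasure (backward_measure k f b 1 z) UNIV \<partial>\<rho>)"
    by (intro emeasure_adjoint_op f sets) auto
  also have "\<dots> = (\<integral>\<^sup>+z. (\<Sum>j=1..k. ennreal (b j)) \<partial>\<rho>)"
    by (subst emeasure_backward_measure_1) (simp_all only: space_in_borel indicator_UNIV mult_1_right)
  also have "\<dots> = (\<Sum>j=1..k. ennreal (b j))"
    by (simp add: emeasure_space_1)
  also have "\<dots> < \<infinity>" by simp
  finally interpret adj: finite_measure "adjoint_op k f b \<rho>"
    by (intro finite_measureI) auto
  have nonneg: "(\<integral>z. \<psi> z \<partial>adjoint_op k f b \<rho>) = (\<integral>z. transition_op k f b \<psi> z \<partial>\<rho>)"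
    if m: "\<psi> \<in> borel_measurable borel" and pos: "\<And>z. \<psi> z \<ge> 0" for \<psi>
  proof -
    have T_pos: "transition_op k f b \<psi> z \<ge> 0" for z
      unfolding transition_op_def using b pos by (intro sum_nonneg mult_nonneg_nonneg) auto
    have sum_eq: "(\<Sum>j=1..k. ennreal (b j) * ennreal (\<psi> (inv (f j) z))) = ennreal (transition_op k f b \<psi> z)" for z
    proof -
      have "(\<Sum>j=1..k. ennreal (b j) * ennreal (\<psi> (inv (f j) z))) =
          (\<Sum>j=1..k. ennreal (b j * \<psi> (inv (f j) z)))"
        by (intro sum.cong ennreal_mult[symmetric] b pos refl)
      also have "\<dots> = ennreal (transition_op k f b \<psi> z)"
        unfolding transition_op_def by (intro sum_ennreal mult_nonneg_nonneg b pos)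
      finally show ?thesis .
    qed
    have "(\<integral>z. \<psi> z \<partial>adjoint_op k f b \<rho>) = enn2real (\<integral>\<^sup>+z. ennreal (\<psi> z) \<partial>adjoint_op k f b \<rho>)"
      using m pos by (intro integral_eq_nn_integral) (simp_all add: meas)
    also have "(\<integral>\<^sup>+z. ennreal (\<psi> z) \<partial>adjoint_op k f b \<rho>)
        = (\<integral>\<^sup>+z. (\<Sum>j=1..k. ennreal (b j) * ennreal (\<psi> (inv (f j) z))) \<partial>\<rho>)"
      using m by (intro nn_integral_adjoint_op f sets) auto
    also have "\<dots> = (\<integral>\<^sup>+z. ennreal (transition_op k f b \<psi> z) \<partial>\<rho>)"
      unfolding sum_eq ..
    also have "enn2real \<dots> = (\<integral>z. transition_op k f b \<psi> z \<partial>\<rho>)"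
      using T_meas[OF m] T_pos by (intro integral_eq_nn_integral[symmetric]) simp_all
    finally show ?thesis .
  qed
  define p where "p = (\<lambda>z. max 0 (\<phi> z))"
  define n where "n = (\<lambda>z. max 0 (- \<phi> z))"
  have pn: "p \<in> borel_measurable borel" "n \<in> borel_measurable borel"
    "\<And>z. p z \<ge> 0" "\<And>z. n z \<ge> 0" "\<And>z. \<bar>p z\<bar> \<le> C" "\<And>z. \<bar>n z\<bar> \<le> C"
    using \<phi> C unfolding p_def n_def by (auto simp: abs_le_iff max_def) (smt (verit) C)+
  have \<phi>_eq: "\<phi> = (\<lambda>z. p z - n z)" by (auto simp: p_def n_def)
  have int: "integrable (adjoint_op k f b \<rho>) \<psi>" "integrable \<rho> (transition_op k f b \<psi>)"
    if "\<psi> \<in> borel_measurable borel" "\<And>z. \<bar>\<psi> z\<bar> \<le> C" for \<psi>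
  proof -
    show "integrable (adjoint_op k f b \<rho>) \<psi>"
      using that by (intro adj.integrable_const_bound[of _ C]) (simp_all add: meas)
    have "\<bar>transition_op k f b \<psi> z\<bar> \<le> (\<Sum>j=1..k. b j * C)" for z
      unfolding transition_op_def using that b
      by (intro order.trans[OF sum_abs] sum_mono) (simp add: abs_mult mult_left_mono)
    then show "integrable \<rho> (transition_op k f b \<psi>)"
      using T_meas[OF that(1)] by (intro integrable_const_bound[of _ "\<Sum>j=1..k. b j * C"]) simp_all
  qed
  have "(\<integral>z. \<phi> z \<partial>adjoint_op k f b \<rho>)
      = (\<integral>z. transition_op k f b p z \<partial>\<rho>) - (\<integral>z. transition_op k f b n z \<partial>\<rho>)"
    unfolding \<phi>_eq using pn by (simp add: int nonneg)
  also have "\<dots> = (\<integral>z. transition_op k f b p z - transition_op k f b n z \<partial>\<rho>)"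
    using pn by (intro Bochner_Integration.integral_diff[symmetric] int)
  also have "\<dots> = (\<integral>z. transition_op k f b \<phi> z \<partial>\<rho>)"
    unfolding \<phi>_eq transition_op_def by (simp add: right_diff_distrib sum_subtractf)
  finally show ?thesis .
qed

end

theory Submission
  imports Defs
begin

text \<open>Put \<open>g\<^sub>j = f\<^sub>j\<^sup>-\<^sup>1\<close>. A sequence of Moebius maps has a subsequence that either converges uniformly
  on the sphere or converges to a constant \<open>p\<close> locally uniformly off a point \<open>q\<close>; in the second case
  \<open>q\<close> lies in the Julia set of the sequence and \<open>p\<close> in that of the inverse sequence. Since the kernel
  Julia set is empty, any two points can be moved by one word in the \<open>g\<^sub>j\<close> into the Fatou set, and
  then, because the Julia set is not empty, brought together and kept together. By compactness the
  expected distance of two points driven by the same random word tends to \<open>0\<close> uniformly, so the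
  oscillation of \<open>T\<^sup>n \<phi>\<close> vanishes, and the random maps \<open>g\<^sub>i\<^sub>1 \<circ> \<dots> \<circ> g\<^sub>i\<^sub>n\<close> converge almost surely along a
  subsequence of \<open>n\<close> to a random point, whose law is the required measure. Its support is closed and
  invariant under the \<open>g\<^sub>j\<close>, hence contains the attracting points \<open>p\<close>, which are dense in \<open>J(G)\<close>;
  conversely \<open>J(G)\<close> is closed and invariant under the \<open>g\<^sub>j\<close>.\<close>

section \<open>Sequences of Moebius maps\<close>

text \<open>The Cauchy-Schwarz inequality for the wedge of two vectors. In Lagrange's identity the
  remainder is the square \<open>(cmod x * cmod u - cmod y * cmod v)\<^sup>2\<close>.\<close>

lemma cmod_wedge_le: "cmod (x * v - y * u) \<le> norm (x, y) * norm (u, v)"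
proof -
  have "cmod (x * v - y * u) \<le> cmod x * cmod v + cmod y * cmod u"
    by (metis norm_mult norm_triangle_ineq4)
  also have "\<dots> \<le> norm (x, y) * norm (u, v)"
  proof (rule power2_le_imp_le)
    show "(cmod x * cmod v + cmod y * cmod u)\<^sup>2 \<le> (norm (x, y) * norm (u, v))\<^sup>2"
    proof -
      have "(norm (x, y) * norm (u, v))\<^sup>2 =
          (cmod x * cmod v + cmod y * cmod u)\<^sup>2 + (cmod x * cmod u - cmod y * cmod v)\<^sup>2"
        by (simp add: norm_Pair power_mult_distrib) (simp add: power2_eq_square algebra_simps)
      then show ?thesis by simp
    qed
  qed simp
  finally show ?thesis .
qed

section \<open>Unit homogeneous coordinates and compactness of the sphere\<close>

lemma hpoint_unit_cases:
  obtains x y where "p = hpoint x y" "norm (x, y) = 1"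
proof -
  obtain x y where p: "p = hpoint x y" "(x, y) \<noteq> 0" by (rule hpoint_cases)
  define t where "t = complex_of_real (1 / norm (x, y))"
  have n: "norm (x, y) \<noteq> 0" using p(2) by (simp only: norm_eq_zero not_False_eq_True)
  then have "t \<noteq> 0" by (simp add: t_def)
  moreover have "norm (t * x, t * y) = 1"
  proof -
    have "norm (t * x, t * y) = norm t * norm (x, y)"
      by (simp add: norm_Pair norm_mult power_mult_distrib real_sqrt_mult flip: distrib_left)
    then show ?thesis using n by (simp add: t_def norm_divide)
  qed
  ultimately show ?thesis using that[of "t * x" "t * y"] p(1) by (simp add: hpoint_scale)
qed

lemma dist_sphere_le_2: "dist (p :: riemann_sphere) q \<le> 2"
proof -
  obtain x y where p: "p = hpoint x y" "norm (x, y) = 1" by (rule hpoint_unit_cases)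
  obtain u v where q: "q = hpoint u v" "norm (u, v) = 1" by (rule hpoint_unit_cases)
  have "(x, y) \<noteq> 0" "(u, v) \<noteq> 0" using p q by auto
  then show ?thesis
    using cmod_wedge_le[of x v y u] by (simp add: p q dist_hpoint)
qed

text \<open>The Hopf map sends the compact unit sphere of \<complex>\<times>\<complex> onto the
  Riemann sphere, and it is 2-Lipschitz there for the chordal metric.\<close>

lemma compact_riemann_sphere: "compact (UNIV :: riemann_sphere set)"
proof -
  let ?S = "sphere (0 :: complex \<times> complex) 1"
  have "continuous_on ?S (\<lambda>v. hpoint (fst v) (snd v))"
  proof (rule lipschitz_on_continuous_on, rule lipschitz_onI)
    fix v w assume "v \<in> ?S" "w \<in> ?S"
    then have n: "norm v = 1" "norm w = 1" "v \<noteq> 0" "w \<noteq> 0" by auto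
    \<comment> \<open>The wedge of \<open>v\<close> with itself is zero, so \<open>w\<close> may be
      replaced by \<open>w - v\<close>.\<close>
    have "cmod (fst v * snd w - snd v * fst w)
        = cmod (fst v * snd (w - v) - snd v * fst (w - v))" by (simp add: algebra_simps)
    also have "\<dots> \<le> norm v * norm (w - v)"
      using cmod_wedge_le[of "fst v" "snd (w - v)" "snd v" "fst (w - v)"] by (simp only: prod.collapse)
    also have "\<dots> = dist v w" using n by (simp add: dist_norm norm_minus_commute)
    finally show "dist (hpoint (fst v) (snd v)) (hpoint (fst w) (snd w)) \<le> 2 * dist v w"
      using n by (simp add: dist_hpoint)
  qed simp
  then have "compact ((\<lambda>v. hpoint (fst v) (snd v)) ` ?S)"
    by (intro compact_continuous_image) auto
  moreover have "p \<in> (\<lambda>v. hpoint (fst v) (snd v)) ` ?S" for p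
  proof -
    obtain x y where p: "p = hpoint x y" "norm (x, y) = 1" by (rule hpoint_unit_cases)
    then show ?thesis by (intro image_eqI[of _ _ "(x, y)"]) auto
  qed
  ultimately show ?thesis by (metis UNIV_eq_I)
qed

text \<open>The wedge of the two image vectors equals that of their difference with the second one,
  hence is small, while the bound \<open>low\<close> keeps both images away from zero. A lower bound
  on one vector stands in for invertibility, so singular matrices are covered.\<close>

lemma dist_moebius_perturb:
  fixes a b c d a' b' c' d' :: complex
  defines "e \<equiv> cmod (a' - a) + cmod (b' - b) + cmod (c' - c) + cmod (d' - d)"
  assumes v: "(x, y) \<noteq> 0" and m: "m > 0" "e \<le> m / 2"
    and low: "m * norm (x, y) \<le> norm (a * x + b * y, c * x + d * y)"
  shows "dist (moebius a' b' c' d' (hpoint x y)) (moebius a b c d (hpoint x y)) \<le> 4 * e / m"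
proof -
  define A where "A = (a * x + b * y, c * x + d * y)"
  define A' where "A' = (a' * x + b' * y, c' * x + d' * y)"
  define N where "N = norm (x, y)"
  have N: "N > 0" using v unfolding N_def by (simp only: zero_less_norm_iff not_False_eq_True)
  have e0: "e \<ge> 0" by (simp add: e_def)
  have diff: "A' - A = ((a' - a) * x + (b' - b) * y, (c' - c) * x + (d' - d) * y)"
    by (simp add: A_def A'_def algebra_simps)
  have d: "norm (A' - A) \<le> e * N"
    unfolding diff e_def N_def by (rule norm_matrix_apply_le)
  have lowA: "m * N \<le> norm A" using low by (simp add: A_def N_def)
  have "norm A - norm (A' - A) \<le> norm A'"
    by (metis norm_minus_commute norm_triangle_ineq2 diff_le_eq add.commute)
  moreover have "e * N \<le> m / 2 * N" using m N by (intro mult_right_mono) auto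
  ultimately have lowA': "m / 2 * N \<le> norm A'" using d lowA by (simp add: field_simps)
  have pos: "norm A > 0" "norm A' > 0"
    using lowA lowA' m N by (smt (verit) mult_pos_pos half_gt_zero)+
  have "cmod (fst A' * snd A - snd A' * fst A)
      = cmod (fst (A' - A) * snd A - snd (A' - A) * fst A)" by (simp add: algebra_simps)
  also have "\<dots> \<le> norm (A' - A) * norm A"
    using cmod_wedge_le[of "fst (A' - A)" "snd A" "snd (A' - A)" "fst A"] by (simp only: prod.collapse)
  also have "\<dots> \<le> e * N * norm A" using d by (intro mult_right_mono) auto
  finally have w: "cmod (fst A' * snd A - snd A' * fst A) \<le> e * N * norm A" .
  have "dist (moebius a' b' c' d' (hpoint x y)) (moebius a b c d (hpoint x y))
     = dist (hpoint (fst A') (snd A')) (hpoint (fst A) (snd A))"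
    by (simp add: moebius_hpoint[OF v] A_def A'_def)
  also have "\<dots> = 2 * cmod (fst A' * snd A - snd A' * fst A) / (norm A' * norm A)"
    using pos by (subst dist_hpoint) auto
  also have "\<dots> \<le> 2 * (e * N * norm A) / (norm A' * norm A)"
    using w pos by (intro divide_right_mono) auto
  also have "\<dots> = 2 * (e * N) / norm A'" using pos by simp
  also have "\<dots> \<le> 2 * (e * N) / (m / 2 * N)"
    using lowA' m N e0 pos by (intro divide_left_mono mult_nonneg_nonneg mult_pos_pos) auto
  also have "\<dots> = 4 * e / m" using N by simp
  finally show ?thesis .
qed

text \<open>The limit matrix is only bounded below on the vectors over \<open>S\<close>. Thus one
  statement serves both for an invertible limit on the whole sphere and for a rank-one limit away
  from its kernel.\<close>

lemma uniform_limit_moebius: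
  assumes lim: "a \<longlonglongrightarrow> a0" "b \<longlonglongrightarrow> b0" "c \<longlonglongrightarrow> c0" "d \<longlonglongrightarrow> d0" and m: "m > 0"
    and low: "\<And>x y. (x, y) \<noteq> 0 \<Longrightarrow> hpoint x y \<in> S \<Longrightarrow>
      m * norm (x, y) \<le> norm (a0 * x + b0 * y, c0 * x + d0 * y)"
  shows "uniform_limit S (\<lambda>n. moebius (a n) (b n) (c n) (d n)) (moebius a0 b0 c0 d0) sequentially"
proof (rule uniform_limitI)
  fix \<epsilon> :: real assume "\<epsilon> > 0"
  define e where "e n = cmod (a n - a0) + cmod (b n - b0) + cmod (c n - c0) + cmod (d n - d0)" for n
  have "e \<longlonglongrightarrow> cmod (a0 - a0) + cmod (b0 - b0) + cmod (c0 - c0) + cmod (d0 - d0)"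
    unfolding e_def by (intro tendsto_intros lim)
  then have "e \<longlonglongrightarrow> 0" by simp
  \<comment> \<open>The first bound meets the hypothesis of \<open>dist_moebius_perturb\<close>; the
    second turns its conclusion \<open>4 * e / m\<close> into less than \<epsilon>/2.\<close>
  moreover have "min (m / 2) (m * \<epsilon> / 8) > 0" using m \<open>\<epsilon> > 0\<close> by simp
  ultimately have "\<forall>\<^sub>F n in sequentially. e n < min (m / 2) (m * \<epsilon> / 8)"
    by (rule order_tendstoD)
  then show "\<forall>\<^sub>F n in sequentially. \<forall>p\<in>S.
      dist (moebius (a n) (b n) (c n) (d n) p) (moebius a0 b0 c0 d0 p) < \<epsilon>"
  proof eventually_elim
    case (elim n)
    show ?case
    proof
      fix p assume "p \<in> S"
      obtain x y where p: "p = hpoint x y" "(x, y) \<noteq> 0" by (rule hpoint_cases)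
      have "dist (moebius (a n) (b n) (c n) (d n) p) (moebius a0 b0 c0 d0 p) \<le> 4 * e n / m"
        unfolding p(1) e_def
        by (rule dist_moebius_perturb[OF p(2) m]) (use elim low p \<open>p \<in> S\<close> in \<open>auto simp: e_def\<close>)
      also have "\<dots> < \<epsilon>" using elim m mult_pos_pos[OF m \<open>\<epsilon> > 0\<close>] by (simp add: field_simps)
      finally show "dist (moebius (a n) (b n) (c n) (d n) p) (moebius a0 b0 c0 d0 p) < \<epsilon>" .
    qed
  qed
qed

text \<open>The sets \<open>dist x q \<ge> r\<close> exhaust the complement of \<open>q\<close>, so
  this is locally uniform convergence to the constant \<open>p\<close> off \<open>q\<close>. Nothing
  is asserted at \<open>q\<close> itself.\<close>

definition collapses ::
  "(nat \<Rightarrow> riemann_sphere \<Rightarrow> riemann_sphere) \<Rightarrow> riemann_sphere \<Rightarrow> riemann_sphere \<Rightarrow> bool" where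
  "collapses h p q \<longleftrightarrow> (\<forall>r>0. uniform_limit {x. dist x q \<ge> r} h (\<lambda>_. p) sequentially)"

lemma collapses_tendsto: "collapses h p q \<Longrightarrow> x \<noteq> q \<Longrightarrow> (\<lambda>n. h n x) \<longlonglongrightarrow> p"
  unfolding collapses_def by (drule spec[of _ "dist x q"]) (auto intro: tendsto_uniform_limitI)

text \<open>The rank-one matrix here is \<open>v \<mapsto> (v \<and> q) p\<close>.\<close>

lemma collapses_rank_one:
  assumes lim: "a \<longlonglongrightarrow> p1 * q2" "b \<longlonglongrightarrow> - (p1 * q1)" "c \<longlonglongrightarrow> p2 * q2" "d \<longlonglongrightarrow> - (p2 * q1)"
    and nz: "(p1, p2) \<noteq> 0" "(q1, q2) \<noteq> 0"
  shows "collapses (\<lambda>n. moebius (a n) (b n) (c n) (d n)) (hpoint p1 p2) (hpoint q1 q2)"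
  unfolding collapses_def
proof safe
  fix r :: real assume r: "r > 0"
  have apply_eq: "p1 * q2 * x + - (p1 * q1) * y = (x * q2 - y * q1) * p1"
    "p2 * q2 * x + - (p2 * q1) * y = (x * q2 - y * q1) * p2" for x y
    by (simp_all add: algebra_simps)
  have norm_eq: "norm (t * p1, t * p2) = cmod t * norm (p1, p2)" for t
    by (simp add: norm_Pair norm_mult power_mult_distrib real_sqrt_mult flip: distrib_left)
  have n: "norm (p1, p2) > 0" "norm (q1, q2) > 0"
    using nz by (simp_all only: zero_less_norm_iff not_False_eq_True)
  have "uniform_limit {x. r \<le> dist x (hpoint q1 q2)} (\<lambda>n. moebius (a n) (b n) (c n) (d n))
      (moebius (p1 * q2) (- (p1 * q1)) (p2 * q2) (- (p2 * q1))) sequentially"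
  proof (rule uniform_limit_moebius[OF lim])
    \<comment> \<open>The distance to \<open>q\<close> is twice the wedge with \<open>q\<close> over
      the product of the norms, so distance at least \<open>r\<close> bounds that wedge from
      below.\<close>
    show "r / 2 * norm (q1, q2) * norm (p1, p2) > 0" using r n by simp
    fix x y :: complex assume v: "(x, y) \<noteq> 0" "hpoint x y \<in> {x. r \<le> dist x (hpoint q1 q2)}"
    have "norm (x, y) > 0" using v(1) by (simp only: zero_less_norm_iff not_False_eq_True)
    then have "r / 2 * norm (q1, q2) * norm (x, y) \<le> cmod (x * q2 - y * q1)"
      using v n by (simp add: dist_hpoint[OF v(1) nz(2)] field_simps)
    then have "r / 2 * norm (q1, q2) * norm (x, y) * norm (p1, p2)
        \<le> cmod (x * q2 - y * q1) * norm (p1, p2)"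
      by (rule mult_right_mono) simp
    then show "r / 2 * norm (q1, q2) * norm (p1, p2) * norm (x, y) \<le>
        norm (p1 * q2 * x + - (p1 * q1) * y, p2 * q2 * x + - (p2 * q1) * y)"
      unfolding apply_eq norm_eq by (simp add: mult_ac)
  qed
  moreover have "moebius (p1 * q2) (- (p1 * q1)) (p2 * q2) (- (p2 * q1)) z = hpoint p1 p2"
    if z: "z \<in> {x. r \<le> dist x (hpoint q1 q2)}" for z
  proof -
    obtain x y where v: "z = hpoint x y" "(x, y) \<noteq> 0" by (rule hpoint_cases)
    have "x * q2 - y * q1 \<noteq> 0" using z r by (auto simp: v(1) dist_hpoint[OF v(2) nz(2)])
    then show ?thesis
      unfolding v(1) moebius_hpoint[OF v(2)] apply_eq by (rule hpoint_scale)
  qed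
  ultimately show "uniform_limit {x. r \<le> dist x (hpoint q1 q2)} (\<lambda>n. moebius (a n) (b n) (c n) (d n))
      (\<lambda>_. hpoint p1 p2) sequentially"
    by (simp add: uniform_limit_iff)
qed

text \<open>A nonzero singular matrix is a column times a row. The column is the first one if that
  is nonzero, otherwise the second; the row is written \<open>(q2, - q1)\<close>, so that
  \<open>q\<close> spans the kernel.\<close>

lemma singular_matrix_rank_one:
  fixes a b c d :: complex
  assumes "a * d = b * c" "\<not> (a = 0 \<and> b = 0 \<and> c = 0 \<and> d = 0)"
  obtains p1 p2 q1 q2 where "a = p1 * q2" "b = - (p1 * q1)" "c = p2 * q2" "d = - (p2 * q1)"
    "(p1, p2) \<noteq> 0" "(q1, q2) \<noteq> 0"
proof (cases "a = 0 \<and> c = 0")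
  case True
  then show ?thesis using that[of b 0 "-1" d] assms by (auto simp: zero_prod_def)
next
  case False
  show ?thesis
  proof (cases "a = 0")
    case True
    then show ?thesis using that[of a 1 "- d / c" c] False assms
      by (auto simp: zero_prod_def field_simps)
  next
    case a: False
    then show ?thesis using that[of a 1 "- b / a" c] assms
      by (auto simp: zero_prod_def field_simps)
  qed
qed

lemma moebius_scale:
  assumes "t \<noteq> 0"
  shows "moebius (t * a) (t * b) (t * c) (t * d) = moebius a b c d"
proof
  fix p
  obtain x y where p: "p = hpoint x y" "(x, y) \<noteq> 0" by (rule hpoint_cases)
  show "moebius (t * a) (t * b) (t * c) (t * d) p = moebius a b c d p"
    unfolding p(1) moebius_hpoint[OF p(2)] using hpoint_scale[OF assms, of "a * x + b * y" "c * x + d * y"]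
    by (simp add: algebra_simps)
qed

text \<open>Scaling puts the matrix on a compact sphere, which is what lets a subsequence of
  matrices converge.\<close>

lemma is_moebius_normalized:
  assumes "is_moebius h"
  obtains a b c d where "a * d - b * c \<noteq> 0" "h = moebius a b c d" "norm ((a, b), (c, d)) = 1"
proof -
  obtain a b c d where det: "a * d - b * c \<noteq> 0" and h: "h = moebius a b c d"
    using assms unfolding is_moebius_def by blast
  define N where "N = norm ((a, b), (c, d))"
  define t where "t = complex_of_real (1 / N)"
  have "((a, b), (c, d)) \<noteq> 0" using det by (auto simp: zero_prod_def)
  then have N: "N > 0" unfolding N_def by (simp only: zero_less_norm_iff not_False_eq_True)
  then have t: "t \<noteq> 0" by (simp add: t_def)
  have "norm ((t * a, t * b), (t * c, t * d)) = cmod t * N"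
    by (simp add: norm_Pair norm_mult power_mult_distrib N_def flip: distrib_left)
       (simp add: real_sqrt_mult)
  also have "\<dots> = 1" using N by (simp add: t_def norm_divide)
  finally have n: "norm ((t * a, t * b), (t * c, t * d)) = 1" .
  have "(t * a) * (t * d) - (t * b) * (t * c) = t\<^sup>2 * (a * d - b * c)"
    by (simp add: power2_eq_square algebra_simps)
  then have "(t * a) * (t * d) - (t * b) * (t * c) \<noteq> 0" using det t by simp
  from that[OF this _ n] show ?thesis using h moebius_scale[OF t] by simp
qed

text \<open>Normalized matrices accumulate at a nonzero matrix \<open>B\<close>. An invertible
  \<open>B\<close> gives uniform convergence; a singular one has rank one, with image
  \<open>p\<close> and kernel \<open>q\<close>. The inverses have the adjugate matrices, whose limit
  has image and kernel exchanged.\<close>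

lemma moebius_sequence_cases:
  assumes h: "\<And>n :: nat. is_moebius (h n)"
  obtains r l where "strict_mono r" "uniform_limit UNIV (\<lambda>n. h (r n)) l sequentially"
  | r p q where "strict_mono r" "collapses (\<lambda>n. h (r n)) p q" "collapses (\<lambda>n. inv (h (r n))) q p"
proof -
  have "\<exists>A. fst (fst A) * snd (snd A) - snd (fst A) * fst (snd A) \<noteq> 0 \<and>
      h n = moebius (fst (fst A)) (snd (fst A)) (fst (snd A)) (snd (snd A)) \<and> norm A = 1" for n
    using is_moebius_normalized[OF h[of n]] by (metis fst_conv snd_conv)
  then obtain A where A: "\<And>n. fst (fst (A n)) * snd (snd (A n)) - snd (fst (A n)) * fst (snd (A n)) \<noteq> 0"
    "\<And>n. h n = moebius (fst (fst (A n))) (snd (fst (A n))) (fst (snd (A n))) (snd (snd (A n)))"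
    "\<And>n. norm (A n) = 1" by metis
  have "compact (sphere (0 :: (complex \<times> complex) \<times> (complex \<times> complex)) 1)" by simp
  moreover have "A n \<in> sphere 0 1" for n using A(3) by simp
  ultimately obtain B r where B: "B \<in> sphere 0 1" and r: "strict_mono r" "(A \<circ> r) \<longlonglongrightarrow> B"
    unfolding compact_def by metis
  define a b c d where "a = fst (fst B)" and "b = snd (fst B)" and "c = fst (snd B)" and "d = snd (snd B)"
  have Beq: "B = ((a, b), (c, d))" by (simp add: a_def b_def c_def d_def)
  have lim: "(\<lambda>n. fst (fst (A (r n)))) \<longlonglongrightarrow> a" "(\<lambda>n. snd (fst (A (r n)))) \<longlonglongrightarrow> b"
    "(\<lambda>n. fst (snd (A (r n)))) \<longlonglongrightarrow> c" "(\<lambda>n. snd (snd (A (r n)))) \<longlonglongrightarrow> d"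
    unfolding a_def b_def c_def d_def using r(2) by (auto intro!: tendsto_fst tendsto_snd simp: o_def)
  show ?thesis
  proof (cases "a * d - b * c = 0")
    case False
    define D where "D = cmod (a * d - b * c)"
    define M where "M = cmod d + cmod (- b) + cmod (- c) + cmod a"
    have D: "D > 0" using False by (simp add: D_def)
    have "M \<noteq> 0" using False by (auto simp: M_def add_nonneg_eq_0_iff)
    moreover have "M \<ge> 0" by (simp add: M_def)
    ultimately have M: "M > 0" by simp
    \<comment> \<open>The adjugate returns the vector times the determinant, which bounds the matrix
      below by \<open>D / M\<close>.\<close>
    have low: "D * norm (x, y) \<le> M * norm (a * x + b * y, c * x + d * y)" for x y
    proof -
      have "norm ((a * d - b * c) * x, (a * d - b * c) * y) = D * norm (x, y)"
        by (simp add: norm_Pair D_def norm_mult power_mult_distrib real_sqrt_mult flip: distrib_left)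
      then show ?thesis
        using norm_matrix_apply_le[of d "a * x + b * y" "- b" "c * x + d * y" "- c" a]
        unfolding matrix_inverse_apply M_def by simp
    qed
    have "uniform_limit UNIV (\<lambda>n. h (r n)) (moebius a b c d) sequentially"
      unfolding A(2)
      by (rule uniform_limit_moebius[OF lim, of "D / M"]) (use D M low in \<open>auto simp: field_simps\<close>)
    then show ?thesis using that(1) r(1) by blast
  next
    case True
    have "\<not> (a = 0 \<and> b = 0 \<and> c = 0 \<and> d = 0)" using B by (auto simp: Beq simp flip: zero_prod_def)
    then obtain p1 p2 q1 q2 where pq: "a = p1 * q2" "b = - (p1 * q1)" "c = p2 * q2" "d = - (p2 * q1)"
      "(p1, p2) \<noteq> 0" "(q1, q2) \<noteq> 0"
      using singular_matrix_rank_one[of a d b c] True by (metis eq_iff_diff_eq_0)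
    have 1: "collapses (\<lambda>n. h (r n)) (hpoint p1 p2) (hpoint q1 q2)"
      unfolding A(2) by (rule collapses_rank_one) (use lim pq in auto)
    \<comment> \<open>The adjugate of the rank-one matrix factors through \<open>q\<close> and
      \<open>- p\<close>; the sign disappears in homogeneous coordinates.\<close>
    have "hpoint (- p1) (- p2) = hpoint p1 p2"
      using hpoint_scale[of "-1" p1 p2] by simp
    moreover have "collapses (\<lambda>n. inv (h (r n))) (hpoint q1 q2) (hpoint (- p1) (- p2))"
      unfolding A(2) inv_moebius[OF A(1)]
    proof (rule collapses_rank_one)
      show "(\<lambda>n. snd (snd (A (r n)))) \<longlonglongrightarrow> q1 * (- p2)" "(\<lambda>n. fst (fst (A (r n)))) \<longlonglongrightarrow> - (q2 * (- p1))"
        using lim pq by (simp_all add: mult.commute)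
      show "(\<lambda>n. - snd (fst (A (r n)))) \<longlonglongrightarrow> - (q1 * (- p1))"
        using tendsto_minus[OF lim(2)] pq by (simp add: mult.commute)
      show "(\<lambda>n. - fst (snd (A (r n)))) \<longlonglongrightarrow> q2 * (- p2)"
        using tendsto_minus[OF lim(3)] pq by (simp add: mult.commute)
    qed (use pq in \<open>auto simp: zero_prod_def\<close>)
    ultimately show ?thesis using that(2) r(1) 1 by simp
  qed
qed

section \<open>Julia sets and collapsing sequences\<close>

lemma normal_family_onD:
  fixes h :: "nat \<Rightarrow> riemann_sphere \<Rightarrow> riemann_sphere"
  assumes "normal_family_on U S" "range h \<subseteq> S"
  obtains r l where "strict_mono r"
    "\<And>K. compact K \<Longrightarrow> K \<subseteq> U \<Longrightarrow> uniform_limit K (\<lambda>n. h (r n)) l sequentially"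
  using assms(1)[unfolded normal_family_on_def, rule_format, OF assms(2)] by auto

lemma open_fatou: "open (fatou S)"
proof (subst open_subopen, rule ballI)
  fix z assume "z \<in> fatou S"
  then obtain U where "open U" "z \<in> U" "normal_family_on U S" unfolding fatou_def by blast
  then show "\<exists>T. open T \<and> z \<in> T \<and> T \<subseteq> fatou S" unfolding fatou_def by blast
qed

lemma closed_julia: "closed (julia S)"
  unfolding julia_def by (simp add: closed_Compl open_fatou)

lemma compact_sphere_closed: "closed (K :: riemann_sphere set) \<Longrightarrow> compact K"
  using compact_Int_closed[OF compact_riemann_sphere] by simp

text \<open>If the family were normal at \<open>q\<close>, the limit near \<open>q\<close> would be
  \<open>p\<close> off \<open>q\<close>. Then a late map would send every point except
  \<open>q\<close> close to \<open>p\<close>, which is impossible for a surjection.\<close>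

lemma collapses_imp_julia:
  assumes h: "range h \<subseteq> S" "\<And>n. surj (h n)" and col: "collapses h p q"
  shows "q \<in> julia S"
proof (rule ccontr)
  assume "q \<notin> julia S"
  then obtain U where U: "open U" "q \<in> U" "normal_family_on U S"
    unfolding julia_def fatou_def by blast
  then obtain s where s: "s > 0" "cball q s \<subseteq> U" using open_contains_cball by blast
  obtain r l where r: "strict_mono r"
    and l: "\<And>K. compact K \<Longrightarrow> K \<subseteq> U \<Longrightarrow> uniform_limit K (\<lambda>n. h (r n)) l sequentially"
    using normal_family_onD[OF U(3) h(1)] by metis
  have near: "uniform_limit (cball q s) (\<lambda>n. h (r n)) l sequentially"
    using l s(2) by (simp add: compact_sphere_closed)
  have lp: "l x = p" if "x \<in> cball q s" "x \<noteq> q" for x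
  proof (rule LIMSEQ_unique)
    show "(\<lambda>n. h (r n) x) \<longlonglongrightarrow> l x" using near that(1) by (rule tendsto_uniform_limitI)
    show "(\<lambda>n. h (r n) x) \<longlonglongrightarrow> p"
      using LIMSEQ_subseq_LIMSEQ[OF collapses_tendsto[OF col that(2)] r] by (simp add: o_def)
  qed
  \<comment> \<open>Two distinct values are required, since one could be attained at
    \<open>q\<close> itself.\<close>
  obtain u v :: riemann_sphere where uv: "u \<noteq> v" "u \<noteq> p" "v \<noteq> p"
    using that[of "Fin 0" "Fin 1"] that[of "Fin 0" Infty] that[of "Fin 1" Infty]
    by (cases "p = Infty"; cases "p = Fin 0") auto
  define e where "e = min (dist u p) (dist v p)"
  have e: "e > 0" using uv by (simp add: e_def)
  have "uniform_limit {x. dist x q \<ge> s} h (\<lambda>_. p) sequentially"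
    using col s(1) unfolding collapses_def by blast
  from uniform_limitD[OF this e]
  have "\<forall>\<^sub>F n in sequentially. \<forall>x\<in>{x. dist x q \<ge> s}. dist (h n x) p < e" .
  then have "\<forall>\<^sub>F n in sequentially. \<forall>x\<in>{x. dist x q \<ge> s}. dist (h (r n) x) p < e"
    by (rule eventually_subseq[OF r])
  moreover have "\<forall>\<^sub>F n in sequentially. \<forall>x\<in>cball q s. dist (h (r n) x) (l x) < e"
    using near e by (rule uniform_limitD)
  ultimately have "\<forall>\<^sub>F n in sequentially. \<forall>x. x \<noteq> q \<longrightarrow> dist (h (r n) x) p < e"
  proof eventually_elim
    case (elim n)
    show ?case
    proof (intro allI impI)
      fix x assume "x \<noteq> q"
      then show "dist (h (r n) x) p < e"
        using elim lp[of x] by (cases "dist x q \<ge> s") (auto simp: dist_commute[of q])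
    qed
  qed
  then obtain n where n: "\<And>x. x \<noteq> q \<Longrightarrow> dist (h (r n) x) p < e"
    using eventually_happens' sequentially_bot by blast
  obtain x where x: "h (r n) x = u" using surjD[OF h(2)] by metis
  obtain y where y: "h (r n) y = v" using surjD[OF h(2)] by metis
  have "x = q" "y = q" using n[of x] n[of y] x y by (auto simp: e_def)
  then show False using x y uv by simp
qed

text \<open>A sequence without locally uniformly convergent subsequences on \<open>U\<close> must
  collapse along a subsequence. Its exceptional point lies in \<open>U\<close>, because a compact
  set missing it would see uniform convergence. So the exceptional points are dense in the Julia
  set.\<close>

lemma julia_collapse:
  assumes S: "\<And>h. h \<in> S \<Longrightarrow> is_moebius h" and z: "z \<in> julia S" "open U" "z \<in> U"
  obtains h p q where "range h \<subseteq> S" "collapses h p q" "collapses (\<lambda>n. inv (h n)) q p" "q \<in> U"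
proof -
  have "\<not> normal_family_on U S" using z unfolding julia_def fatou_def by blast
  then obtain h :: "nat \<Rightarrow> riemann_sphere \<Rightarrow> riemann_sphere" where h: "range h \<subseteq> S"
    and not_conv: "\<And>r l. strict_mono r \<Longrightarrow>
      \<exists>K. compact K \<and> K \<subseteq> U \<and> \<not> uniform_limit K (\<lambda>n. h (r n)) l sequentially"
    unfolding normal_family_on_def by auto
  have "is_moebius (h n)" for n using h S by blast
  then show ?thesis
  proof (cases h rule: moebius_sequence_cases)
    case (1 r l)
    then show ?thesis using not_conv[of r l] uniform_limit_on_subset[OF _ subset_UNIV] by blast
  next
    case (2 r p q)
    obtain K where K: "compact K" "K \<subseteq> U" "\<not> uniform_limit K (\<lambda>n. h (r n)) (\<lambda>_. p) sequentially"
      using not_conv[OF 2(1)] by blast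
    have "q \<in> U"
    proof (rule ccontr)
      assume "q \<notin> U"
      then have "q \<notin> K" using K by blast
      moreover have "open (- K)" using compact_imp_closed[OF K(1)] by (rule open_Compl)
      ultimately obtain d where d: "d > 0" "ball q d \<subseteq> - K" using open_contains_ball by blast
      then have "K \<subseteq> {x. dist x q \<ge> d}" by (force simp: dist_commute)
      then show False
        using K(3) 2(2) d(1) uniform_limit_on_subset unfolding collapses_def by blast
    qed
    then show ?thesis using that[of "\<lambda>n. h (r n)" p q] 2 h by auto
  qed
qed

text \<open>Otherwise maps of the family separate points of balls shrinking to \<open>z\<close> by
  \<epsilon>. A subsequence converges uniformly near \<open>z\<close> to a continuous limit
  \<open>l\<close>, and both images tend to \<open>l z\<close>.\<close>

lemma fatou_equicontinuous:
  assumes S: "\<And>h. h \<in> S \<Longrightarrow> is_moebius h" and z: "z \<in> fatou S" and "\<epsilon> > 0"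
  obtains V where "open V" "z \<in> V" "\<And>h x y. h \<in> S \<Longrightarrow> x \<in> V \<Longrightarrow> y \<in> V \<Longrightarrow> dist (h x) (h y) < \<epsilon>"
proof (rule ccontr)
  assume "\<not> thesis"
  then have "\<exists>h x y. h \<in> S \<and> x \<in> ball z (1 / Suc n) \<and> y \<in> ball z (1 / Suc n) \<and> \<not> dist (h x) (h y) < \<epsilon>"
    for n :: nat
    using that[of "ball z (1 / Suc n)"] by (simp only: open_ball centre_in_ball) (simp, blast)
  then obtain h x y where h: "\<And>n. h n \<in> S" and xy: "\<And>n. x n \<in> ball z (1 / Suc n)"
    "\<And>n. y n \<in> ball z (1 / Suc n)" and far: "\<And>n. \<not> dist (h n (x n)) (h n (y n)) < \<epsilon>"
    by metis
  obtain U where U: "open U" "z \<in> U" "normal_family_on U S" using z unfolding fatou_def by blast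
  then obtain s where s: "s > 0" "cball z s \<subseteq> U" using open_contains_cball by blast
  have "range h \<subseteq> S" using h by blast
  from normal_family_onD[OF U(3) this] obtain r l where r: "strict_mono r"
    and l: "\<And>K. compact K \<Longrightarrow> K \<subseteq> U \<Longrightarrow> uniform_limit K (\<lambda>n. h (r n)) l sequentially"
    by metis
  have near: "uniform_limit (cball z s) (\<lambda>n. h (r n)) l sequentially"
    using l s(2) by (simp add: compact_sphere_closed)
  have cont: "continuous_on (cball z s) l"
    by (rule uniform_limit_theorem[OF _ near]) (auto intro!: always_eventually continuous_on_moebius S h)
  then obtain d where d: "d > 0" "\<And>x. x \<in> cball z s \<Longrightarrow> dist x z < d \<Longrightarrow> dist (l x) (l z) < \<epsilon> / 4"
    using s \<open>\<epsilon> > 0\<close> unfolding continuous_on_iff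
    by (elim ballE[of _ _ z] allE[of _ "\<epsilon> / 4"]) auto
  have "(\<lambda>n. 1 / Suc (r n)) \<longlonglongrightarrow> 0"
    using LIMSEQ_subseq_LIMSEQ[OF LIMSEQ_Suc[OF lim_1_over_n[where 'a = real]] r] by (simp add: o_def)
  then have "\<forall>\<^sub>F n in sequentially. 1 / Suc (r n) < min s d"
    by (rule order_tendstoD) (use s d in auto)
  moreover have "\<forall>\<^sub>F n in sequentially. \<forall>x\<in>cball z s. dist (h (r n) x) (l x) < \<epsilon> / 4"
    using near \<open>\<epsilon> > 0\<close> by (intro uniform_limitD) auto
  ultimately have "\<forall>\<^sub>F n in sequentially. False"
  proof eventually_elim
    case (elim n)
    have "dist (h (r n) w) (l z) < \<epsilon> / 2" if "w \<in> ball z (1 / Suc (r n))" for w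
    proof -
      have w: "w \<in> cball z s" "dist w z < d" using that elim(1) by (auto simp: dist_commute)
      then have "dist (h (r n) w) (l w) < \<epsilon> / 4" using elim(2) by blast
      then show ?thesis using d(2)[OF w] dist_triangle[of "h (r n) w" "l z" "l w"] by linarith
    qed
    from this[OF xy(1)] this[OF xy(2)] far[of "r n"] show False
      using dist_triangle2[of "h (r n) (x (r n))" "h (r n) (y (r n))" "l z"] by linarith
  qed
  then show False by simp
qed

lemma fatou_image:
  assumes h: "is_moebius h" "\<And>u. u \<in> S \<Longrightarrow> u \<circ> h \<in> S" and z: "z \<in> fatou S"
  shows "h z \<in> fatou S"
proof -
  obtain U where U: "open U" "z \<in> U" "normal_family_on U S" using z unfolding fatou_def by blast
  have bij: "bij h" using h(1) by (rule bij_moebius)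
  have inv: "continuous_on A (inv h)" for A by (intro continuous_on_moebius is_moebius_inv h)
  have "h ` U = inv h -` U" using bij by (simp add: bij_vimage_eq_inv_image bij_imp_bij_inv inv_inv_eq)
  moreover have "open (inv h -` U)" by (rule open_vimage[OF U(1) inv])
  ultimately have "open (h ` U)" by simp
  moreover have "normal_family_on (h ` U) S"
    unfolding normal_family_on_def
  proof safe
    fix u :: "nat \<Rightarrow> _" assume "range u \<subseteq> S"
    then have "range (\<lambda>n. u n \<circ> h) \<subseteq> S" using h(2) by blast
    from normal_family_onD[OF U(3) this] obtain r l where r: "strict_mono r"
      and l: "\<And>K. compact K \<Longrightarrow> K \<subseteq> U \<Longrightarrow> uniform_limit K (\<lambda>n. u (r n) \<circ> h) l sequentially"
      by metis
    have "uniform_limit K (\<lambda>n. u (r n)) (l \<circ> inv h) sequentially" if K: "compact K" "K \<subseteq> h ` U" for K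
    proof -
      have "inv h ` K \<subseteq> U" using K(2) bij by (auto simp: bij_is_inj)
      then have lim: "uniform_limit (inv h ` K) (\<lambda>n. u (r n) \<circ> h) l sequentially"
        by (intro l compact_continuous_image inv K)
      then show ?thesis using bij by (simp add: uniform_limit_iff surj_f_inv_f bij_is_surj)
    qed
    then show "\<exists>r l. strict_mono r \<and> (\<forall>K. compact K \<and> K \<subseteq> h ` U \<longrightarrow>
        uniform_limit K (\<lambda>n. u (r n)) l sequentially)" using r by blast
  qed
  ultimately show ?thesis using U(2) unfolding fatou_def by blast
qed

section \<open>Words in the inverse generators\<close>

lemma is_moebius_comp:
  assumes "is_moebius g" "is_moebius h"
  shows "is_moebius (g \<circ> h)"
proof -
  obtain a b c d where g: "a * d - b * c \<noteq> 0" "g = moebius a b c d"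
    using assms(1) unfolding is_moebius_def by blast
  obtain a' b' c' d' where h: "a' * d' - b' * c' \<noteq> 0" "h = moebius a' b' c' d'"
    using assms(2) unfolding is_moebius_def by blast
  have "g \<circ> h = moebius (a * a' + b * c') (a * b' + b * d') (c * a' + d * c') (c * b' + d * d')"
  proof
    fix p
    obtain x y where p: "p = hpoint x y" "(x, y) \<noteq> 0" by (rule hpoint_cases)
    show "(g \<circ> h) p = moebius (a * a' + b * c') (a * b' + b * d') (c * a' + d * c') (c * b' + d * d') p"
      unfolding g(2) h(2) o_apply p(1) moebius_hpoint[OF p(2)] 
        moebius_hpoint[OF matrix_apply_nonzero[OF h(1) p(2)]]
      by (simp add: algebra_simps)
  qed
  moreover have "(a * a' + b * c') * (c * b' + d * d') - (a * b' + b * d') * (c * a' + d * c')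
      = (a * d - b * c) * (a' * d' - b' * c')" by (simp add: algebra_simps)
  ultimately show ?thesis unfolding is_moebius_def using g(1) h(1) by (intro exI conjI) auto
qed

lemma backward_image_simps [simp]:
  "backward_image f [] = (\<lambda>a. a)"
  "backward_image f (i # w) = backward_image f w \<circ> inv (f i)"
  by (auto simp: backward_image_def fun_eq_iff)

lemma backward_image_append: "backward_image f (v @ w) = backward_image f w \<circ> backward_image f v"
  by (auto simp: backward_image_def fun_eq_iff)

text \<open>Inversion reverses a composition and \<open>backward_image\<close> applies the first
  letter first. The two reversals cancel, so composing in the semigroup is concatenating
  words.\<close>

lemma inverse_semigroup_words:
  assumes f: "\<And>i. i \<in> I \<Longrightarrow> bij (f i)"
  shows "inverse_semigroup (generated_semigroup (f ` I)) = {backward_image f w |w. w \<noteq> [] \<and> set w \<subseteq> I}"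
proof (intro equalityI subsetI)
  fix h assume "h \<in> inverse_semigroup (generated_semigroup (f ` I))"
  then obtain g where g: "g \<in> generated_semigroup (f ` I)" "h = inv g"
    unfolding inverse_semigroup_def by blast
  from g(1) have "bij g \<and> (\<exists>w. w \<noteq> [] \<and> set w \<subseteq> I \<and> inv g = backward_image f w)"
  proof induction
    case (generator g)
    then obtain i where "i \<in> I" "g = f i" by blast
    then show ?case using f by (intro conjI exI[of _ "[i]"]) (auto simp: fun_eq_iff)
  next
    case (comp g h)
    then obtain v w where v: "v \<noteq> []" "set v \<subseteq> I" "inv g = backward_image f v"
      and w: "w \<noteq> []" "set w \<subseteq> I" "inv h = backward_image f w" by blast
    have "inv (g \<circ> h) = backward_image f (v @ w)"
      using comp.IH v w by (simp add: o_inv_distrib backward_image_append)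
    moreover have "bij (g \<circ> h)" using comp.IH by (auto intro: bij_comp)
    ultimately show ?case using v(1,2) w(2) by (intro conjI exI[of _ "v @ w"]) (auto simp: o_def)
  qed
  then show "h \<in> {backward_image f w |w. w \<noteq> [] \<and> set w \<subseteq> I}" using g(2) by auto
next
  fix h assume "h \<in> {backward_image f w |w. w \<noteq> [] \<and> set w \<subseteq> I}"
  then obtain w where w: "w \<noteq> []" "set w \<subseteq> I" "h = backward_image f w" by blast
  from w(1,2) have "\<exists>g \<in> generated_semigroup (f ` I). bij g \<and> inv g = backward_image f w"
  proof (induction w rule: list_nonempty_induct)
    case (single i)
    then show ?case using f by (intro bexI[of _ "f i"] generated_semigroup.generator) (auto simp: fun_eq_iff)
  next
    case (cons i w)
    then obtain g where g: "g \<in> generated_semigroup (f ` I)" "bij g" "inv g = backward_image f w" by auto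
    then have "inv (f i \<circ> g) = backward_image f (i # w)" "bij (f i \<circ> g)"
      using f[of i] cons.prems by (auto simp: o_inv_distrib intro: bij_comp)
    moreover have "f i \<circ> g \<in> generated_semigroup (f ` I)"
      using cons.prems g(1) by (intro generated_semigroup.comp[OF generated_semigroup.generator]) auto
    ultimately show ?case by blast
  qed
  then show "h \<in> inverse_semigroup (generated_semigroup (f ` I))"
    unfolding inverse_semigroup_def w(3) by (metis imageI)
qed

section \<open>Contraction of pairs of points\<close>

locale probability_vector =
  fixes k :: nat and b :: "nat \<Rightarrow> real"
  assumes b: "\<And>j. j \<in> {1..k} \<Longrightarrow> b j > 0" and b_sum: "(\<Sum>j=1..k. b j) = 1"
begin

lemma k_pos: "k \<ge> 1"
  using b_sum by (cases k) auto

text \<open>The transition operator for arbitrary maps on any type, so that it can be used both on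
  points and on pairs moved by the same letter.\<close>

definition average :: "(nat \<Rightarrow> 'a \<Rightarrow> 'a) \<Rightarrow> ('a \<Rightarrow> real) \<Rightarrow> 'a \<Rightarrow> real" where
  "average g \<phi> x = (\<Sum>j=1..k. b j * \<phi> (g j x))"

lemma average_mono: "(\<And>x. \<phi> x \<le> \<psi> x) \<Longrightarrow> average g \<phi> x \<le> average g \<psi> x"
  unfolding average_def using b by (intro sum_mono mult_left_mono) (auto intro: less_imp_le)

lemma average_pow_mono: "(\<And>x. \<phi> x \<le> \<psi> x) \<Longrightarrow> (average g ^^ n) \<phi> x \<le> (average g ^^ n) \<psi> x"
  by (induction n arbitrary: x) (auto intro: average_mono)

lemma average_affine: "average g (\<lambda>x. c + d * \<phi> x) = (\<lambda>x. c + d * average g \<phi> x)"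
proof
  fix x
  have "average g (\<lambda>x. c + d * \<phi> x) x = (\<Sum>j=1..k. b j * c + d * (b j * \<phi> (g j x)))"
    unfolding average_def by (simp add: algebra_simps)
  also have "\<dots> = c + d * average g \<phi> x"
    using b_sum by (simp add: sum.distrib average_def flip: sum_distrib_left sum_distrib_right)
  finally show "average g (\<lambda>x. c + d * \<phi> x) x = c + d * average g \<phi> x" .
qed

lemma average_pow_affine: "(average g ^^ n) (\<lambda>x. c + d * \<phi> x) = (\<lambda>x. c + d * (average g ^^ n) \<phi> x)"
  by (induction n) (auto simp: average_affine)

lemma average_pow_const: "(average g ^^ n) (\<lambda>_. c) = (\<lambda>_. c)"
  using average_pow_affine[of n g c 0] by simp

end

locale contracting_moebius_walk = probability_vector +
  fixes f :: "nat \<Rightarrow> riemann_sphere \<Rightarrow> riemann_sphere"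
    and H :: "(riemann_sphere \<Rightarrow> riemann_sphere) set"
  assumes f: "\<And>j. j \<in> {1..k} \<Longrightarrow> is_moebius (f j)"
    and H_def: "H = inverse_semigroup (generated_semigroup (f ` {1..k}))"
    and kernel: "kernel_julia H = {}"
    and julia: "julia H \<noteq> {}"
begin

lemma is_moebius_backward_image: "set w \<subseteq> {1..k} \<Longrightarrow> is_moebius (backward_image f w)"
proof (induction w)
  case Nil
  have "moebius 1 0 0 1 p = p" for p by (cases p) auto
  then have "(\<lambda>a. a) = moebius 1 0 0 1" by auto
  then show ?case unfolding is_moebius_def by (intro exI[of _ 1] exI[of _ 0] conjI) auto
next
  case (Cons i w)
  then show ?case using f by (auto intro!: is_moebius_comp is_moebius_inv simp del: o_apply)
qed

lemma H_eq: "H = {backward_image f w |w. w \<noteq> [] \<and> set w \<subseteq> {1..k}}"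
  unfolding H_def by (rule inverse_semigroup_words) (simp add: f bij_moebius)

lemma backward_image_in_H: "w \<noteq> [] \<Longrightarrow> set w \<subseteq> {1..k} \<Longrightarrow> backward_image f w \<in> H"
  unfolding H_eq by blast

lemma H_moebius: "h \<in> H \<Longrightarrow> is_moebius h"
  unfolding H_eq using is_moebius_backward_image by blast

lemma H_comp:
  assumes "g \<in> H" "h \<in> H"
  shows "g \<circ> h \<in> H"
proof -
  obtain v w where "v \<noteq> []" "set v \<subseteq> {1..k}" "g = backward_image f v"
    "w \<noteq> []" "set w \<subseteq> {1..k}" "h = backward_image f w"
    using assms unfolding H_eq by blast
  then show ?thesis
    using backward_image_in_H[of "w @ v"] by (simp add: backward_image_append)
qed

lemma fatou_H_image: "h \<in> H \<Longrightarrow> z \<in> fatou H \<Longrightarrow> h z \<in> fatou H"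
  by (rule fatou_image) (auto simp: H_moebius intro: H_comp)

text \<open>The emptiness of the kernel Julia set, read at one point.\<close>

lemma ex_into_fatou: "\<exists>h\<in>H. h z \<in> fatou H"
  using kernel unfolding kernel_julia_def julia_def by blast

text \<open>Quantifying over all words, the empty one included, makes the property absorbing for the
  walk of pairs.\<close>

definition steadily_close :: "real \<Rightarrow> riemann_sphere \<times> riemann_sphere \<Rightarrow> bool" where
  "steadily_close \<epsilon> x \<longleftrightarrow>
     (\<forall>v. set v \<subseteq> {1..k} \<longrightarrow> dist (backward_image f v (fst x)) (backward_image f v (snd x)) < \<epsilon>)"

lemma steadily_close_backward_image:
  assumes "steadily_close \<epsilon> x" "set w \<subseteq> {1..k}"
  shows "steadily_close \<epsilon> (map_prod (backward_image f w) (backward_image f w) x)"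
  unfolding steadily_close_def
proof safe
  fix v assume "set v \<subseteq> {1..k}"
  then have "set (w @ v) \<subseteq> {1..k}" using assms(2) by simp
  then have "dist (backward_image f (w @ v) (fst x)) (backward_image f (w @ v) (snd x)) < \<epsilon>"
    using assms(1) unfolding steadily_close_def by blast
  then show "dist (backward_image f v (fst (map_prod (backward_image f w) (backward_image f w) x)))
      (backward_image f v (snd (map_prod (backward_image f w) (backward_image f w) x))) < \<epsilon>"
    by (simp add: backward_image_append)
qed

text \<open>Any two points can be moved into the Fatou set, then together by a collapsing sequence, and
  finally to a point of equicontinuity, after which they stay together.\<close>

lemma ex_steadily_close:
  assumes "\<epsilon> > 0"
  obtains w W where "set w \<subseteq> {1..k}" "open W" "x \<in> W"
    "\<And>y. y \<in> W \<Longrightarrow> steadily_close \<epsilon> (map_prod (backward_image f w) (backward_image f w) y)"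
proof -
  obtain h1 where h1: "h1 \<in> H" "h1 (fst x) \<in> fatou H" using ex_into_fatou by blast
  \<comment> \<open>\<open>h2\<close> is chosen for the second point as already moved by
    \<open>h1\<close>; the first point stays in the Fatou set by forward invariance.\<close>
  obtain h2 where h2: "h2 \<in> H" "h2 (h1 (snd x)) \<in> fatou H" using ex_into_fatou by blast
  have F: "h2 (h1 (fst x)) \<in> fatou H" using fatou_H_image h1 h2 by blast
  obtain q0 where "q0 \<in> julia H" using julia by blast
  then obtain h p q where h: "range h \<subseteq> H" "collapses h p q"
    using julia_collapse[OF H_moebius _ open_UNIV UNIV_I] by metis
  have "surj (h n)" for n using h(1) by (intro bij_is_surj bij_moebius H_moebius) auto
  \<comment> \<open>Both points lie in the Fatou set, so neither is the exceptional point and both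
    are drawn to \<open>p\<close>.\<close>
  then have "q \<in> julia H" using collapses_imp_julia[OF h(1) _ h(2)] by blast
  then have "h2 (h1 (fst x)) \<noteq> q" "h2 (h1 (snd x)) \<noteq> q" using F h2 by (auto simp: julia_def)
  then have lim: "(\<lambda>n. h n (h2 (h1 (fst x)))) \<longlonglongrightarrow> p" "(\<lambda>n. h n (h2 (h1 (snd x)))) \<longlonglongrightarrow> p"
    using collapses_tendsto[OF h(2)] by blast+
  \<comment> \<open>The common limit \<open>p\<close> may be a Julia point, so one more map takes it
    to a point of equicontinuity.\<close>
  obtain h3 where h3: "h3 \<in> H" "h3 p \<in> fatou H" using ex_into_fatou by blast
  have cont: "isCont g z" if "g \<in> H" for g z
    using continuous_on_moebius[OF H_moebius[OF that], of UNIV] by (simp add: continuous_on_eq_continuous_at)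
  have lim: "(\<lambda>n. h3 (h n (h2 (h1 (fst x))))) \<longlonglongrightarrow> h3 p" "(\<lambda>n. h3 (h n (h2 (h1 (snd x))))) \<longlonglongrightarrow> h3 p"
    using isCont_tendsto_compose[OF cont[OF h3(1)]] lim by blast+
  obtain V where V: "open V" "h3 p \<in> V" "\<And>h x y. h \<in> H \<Longrightarrow> x \<in> V \<Longrightarrow> y \<in> V \<Longrightarrow> dist (h x) (h y) < \<epsilon>"
    using fatou_equicontinuous[OF H_moebius h3(2) assms] by metis
  \<comment> \<open>Equicontinuity covers nonempty words only; the ball takes care of the empty
    word.\<close>
  define V' where "V' = V \<inter> ball (h3 p) (\<epsilon> / 2)"
  have V': "open V'" "h3 p \<in> V'" using V assms by (auto simp: V'_def)
  have "\<forall>\<^sub>F n in sequentially. h3 (h n (h2 (h1 (fst x)))) \<in> V' \<and> h3 (h n (h2 (h1 (snd x)))) \<in> V'"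
    by (intro eventually_conj topological_tendstoD[OF lim(1)] topological_tendstoD[OF lim(2)] V')
  then obtain n where n: "h3 (h n (h2 (h1 (fst x)))) \<in> V'" "h3 (h n (h2 (h1 (snd x)))) \<in> V'"
    using eventually_happens' sequentially_bot by blast
  define g where "g = h3 \<circ> (h n \<circ> (h2 \<circ> h1))"
  have "g \<in> H" unfolding g_def using h(1) by (intro H_comp h1 h2 h3) auto
  then obtain w where w: "g = backward_image f w" "set w \<subseteq> {1..k}" unfolding H_eq by blast
  have close: "steadily_close \<epsilon> y" if "y \<in> V' \<times> V'" for y
    unfolding steadily_close_def
  proof safe
    fix v assume v: "set v \<subseteq> {1..k}"
    show "dist (backward_image f v (fst y)) (backward_image f v (snd y)) < \<epsilon>"
    proof (cases "v = []")
      case True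
      have "dist (h3 p) (fst y) < \<epsilon> / 2" "dist (h3 p) (snd y) < \<epsilon> / 2" using that by (auto simp: V'_def)
      then show ?thesis using True dist_triangle3[of "fst y" "snd y" "h3 p"] by simp
    next
      case False
      then show ?thesis using V(3) backward_image_in_H[OF False v] that by (auto simp: V'_def)
    qed
  qed
  show ?thesis
  proof (rule that[OF w(2)])
    have "continuous_on UNIV (map_prod g g)"
      unfolding map_prod_def split_beta
      by (intro continuous_on_Pair continuous_on_compose2[OF continuous_on_moebius[OF H_moebius[OF \<open>g \<in> H\<close>], of UNIV]]
          continuous_on_fst continuous_on_snd continuous_on_id) auto
    then show "open (map_prod g g -` (V' \<times> V'))" by (intro open_vimage open_Times V')
    show "x \<in> map_prod g g -` (V' \<times> V')" using n by (cases x) (simp add: g_def)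
    fix y assume "y \<in> map_prod g g -` (V' \<times> V')"
    then show "steadily_close \<epsilon> (map_prod (backward_image f w) (backward_image f w) y)"
      using close w by auto
  qed
qed

text \<open>Compactness of the space of pairs leaves finitely many words, and these can be padded to
  one length because the property is absorbing.\<close>

lemma uniform_steadily_close:
  assumes "\<epsilon> > 0"
  obtains N where "\<And>x. \<exists>w\<in>words k N. steadily_close \<epsilon> (map_prod (backward_image f w) (backward_image f w) x)"
proof -
  define P where "P w W \<longleftrightarrow> set w \<subseteq> {1..k} \<and> open W \<and>
    (\<forall>y\<in>W. steadily_close \<epsilon> (map_prod (backward_image f w) (backward_image f w) y))" for w W
  have "\<exists>w W. x \<in> W \<and> P w W" for x
    using ex_steadily_close[OF assms, of x] unfolding P_def by metis
  then obtain w W where wW: "\<And>x. x \<in> W x" "\<And>x. P (w x) (W x)" by metis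
  have "compact (UNIV :: (riemann_sphere \<times> riemann_sphere) set)"
    using compact_Times[OF compact_riemann_sphere compact_riemann_sphere] by simp
  then obtain C where C: "finite C" "UNIV \<subseteq> (\<Union>x\<in>C. W x)"
    using compactE_image[of UNIV UNIV W] wW unfolding P_def by (metis UNIV_I UN_I subsetI)
  define N where "N = Max (length ` w ` C)"
  have "\<exists>u\<in>words k N. steadily_close \<epsilon> (map_prod (backward_image f u) (backward_image f u) y)" for y
  proof -
    obtain x where x: "x \<in> C" "y \<in> W x" using C(2) by blast
    \<comment> \<open>The letter 1 is an arbitrary filler from \<open>{1..k}\<close>.\<close>
    define u where "u = w x @ replicate (N - length (w x)) 1"
    have len: "length (w x) \<le> N" unfolding N_def using C(1) x by (intro Max_ge) auto
    have u: "u \<in> words k N" using len wW(2)[of x] k_pos by (auto simp: words_def u_def P_def)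
    have "steadily_close \<epsilon> (map_prod (backward_image f (w x)) (backward_image f (w x)) y)"
      using wW(2)[of x] x unfolding P_def by blast
    moreover have "set (replicate (N - length (w x)) 1) \<subseteq> {1..k}" using k_pos by auto
    ultimately have "steadily_close \<epsilon> (map_prod (backward_image f u) (backward_image f u) y)"
      using steadily_close_backward_image[of \<epsilon> _ "replicate (N - length (w x)) 1"]
      by (simp only: u_def backward_image_append flip: prod.map_comp)
    with u show ?thesis by blast
  qed
  then show ?thesis by (rule that)
qed

section \<open>The walk of pairs driven by one random word\<close>

abbreviation pair_op :: "(riemann_sphere \<times> riemann_sphere \<Rightarrow> real) \<Rightarrow> riemann_sphere \<times> riemann_sphere \<Rightarrow> real"
  where "pair_op \<equiv> average (\<lambda>j. map_prod (inv (f j)) (inv (f j)))"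

text \<open>The word \<open>w\<close> has probability \<open>prod_list (map b w)\<close> and
  contributes zero; all other words of its length contribute at most their probability.\<close>

lemma pair_op_pow_le_word:
  assumes \<psi>: "\<And>x. 0 \<le> \<psi> x" "\<And>x. \<psi> x \<le> 1"
    and w: "set w \<subseteq> {1..k}" "\<psi> (map_prod (backward_image f w) (backward_image f w) x) = 0"
  shows "(pair_op ^^ length w) \<psi> x \<le> 1 - prod_list (map b w)"
  using w
proof (induction w arbitrary: x)
  case (Cons i w)
  let ?g = "\<lambda>j. map_prod (inv (f j)) (inv (f j))"
  have one: "(pair_op ^^ n) \<psi> y \<le> 1" for n y
    using average_pow_mono[of \<psi> "\<lambda>_. 1"] \<psi> by (simp add: average_pow_const)
  have i: "i \<in> {1..k}" using Cons.prems by simp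
  have "(pair_op ^^ length (i # w)) \<psi> x = (\<Sum>j=1..k. b j * (pair_op ^^ length w) \<psi> (?g j x))"
    by (simp add: average_def)
  also have "\<dots> = b i * (pair_op ^^ length w) \<psi> (?g i x)
      + (\<Sum>j\<in>{1..k} - {i}. b j * (pair_op ^^ length w) \<psi> (?g j x))"
    using i by (intro sum.remove) auto
  also have "\<dots> \<le> b i * (1 - prod_list (map b w)) + (\<Sum>j\<in>{1..k} - {i}. b j * 1)"
  proof (intro add_mono mult_left_mono sum_mono one)
    show "(pair_op ^^ length w) \<psi> (?g i x) \<le> 1 - prod_list (map b w)"
      using Cons.prems by (intro Cons.IH) (auto simp: prod.map_comp o_def)
  qed (use b i in \<open>auto intro: less_imp_le\<close>)
  also have "\<dots> = 1 - prod_list (map b (i # w))"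
    using b_sum sum.remove[of "{1..k}" i b] i by (simp add: algebra_simps)
  finally show ?case .
qed simp

text \<open>\<open>B\<close> marks the pairs that are not yet steadily close. Its expectation never
  increases and falls by a fixed factor over each block of \<open>N\<close> letters, so it decays
  geometrically and controls the expected distance.\<close>

lemma pair_contraction:
  assumes "\<epsilon> > 0"
  shows "\<exists>n0. \<forall>n\<ge>n0. \<forall>x. (pair_op ^^ n) (\<lambda>x. dist (fst x) (snd x)) x \<le> \<epsilon>"
proof -
  define B where "B x = (if steadily_close (\<epsilon> / 2) x then 0 else 1 :: real)" for x
  have B01: "0 \<le> B x" "B x \<le> 1" for x by (auto simp: B_def)
  have step: "pair_op B x \<le> B x" for x
  proof (cases "steadily_close (\<epsilon> / 2) x")
    case True
    have "B (map_prod (inv (f j)) (inv (f j)) x) = 0" if "j \<in> {1..k}" for j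
      using steadily_close_backward_image[OF True, of "[j]"] that by (simp add: B_def o_def)
    then show ?thesis using True by (simp add: average_def B_def)
  next
    case False
    have "pair_op B x \<le> pair_op (\<lambda>x. 1 + 0 * B x) x" using B01 by (intro average_mono) simp
    then show ?thesis using False unfolding average_affine by (simp add: B_def)
  qed
  have decr: "(pair_op ^^ (m + n)) B x \<le> (pair_op ^^ n) B x" for m n x
  proof (induction m arbitrary: x)
    case (Suc m)
    have "(pair_op ^^ (Suc m + n)) B x = (pair_op ^^ (m + n)) (pair_op B) x"
      by (simp add: funpow_swap1)
    also have "\<dots> \<le> (pair_op ^^ (m + n)) B x" by (intro average_pow_mono step)
    finally show ?case using Suc.IH[of x] by simp
  qed simp
  obtain N where N: "\<And>x. \<exists>w\<in>words k N. steadily_close (\<epsilon> / 2) (map_prod (backward_image f w) (backward_image f w) x)"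
    using uniform_steadily_close[of "\<epsilon> / 2"] assms by auto
  define p where "p = Min ((\<lambda>w. prod_list (map b w)) ` words k N)"
  have "words k N \<noteq> {}" using N by blast
  then have "p \<in> (\<lambda>w. prod_list (map b w)) ` words k N" unfolding p_def by (intro Min_in) (auto simp: finite_words)
  moreover have "prod_list (map b w) > 0" if "set w \<subseteq> {1..k}" for w
    using that by (induction w) (auto simp: b)
  ultimately have p: "p > 0" by (auto simp: words_def)
  \<comment> \<open>The maximum makes \<open>q\<close> nonnegative whatever the size of
    \<open>p\<close>.\<close>
  define q where "q = max 0 (1 - p)"
  have q: "0 \<le> q" "q < 1" using p by (auto simp: q_def)
  have block: "(pair_op ^^ N) B x \<le> q * B x" for x
  proof (cases "steadily_close (\<epsilon> / 2) x")
    case True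
    then show ?thesis using decr[of N 0 x] by (simp add: B_def)
  next
    case False
    obtain w where w: "w \<in> words k N" "steadily_close (\<epsilon> / 2) (map_prod (backward_image f w) (backward_image f w) x)"
      using N by blast
    have "p \<le> prod_list (map b w)" unfolding p_def using w by (intro Min_le) (auto simp: finite_words)
    moreover have "(pair_op ^^ length w) B x \<le> 1 - prod_list (map b w)"
      by (rule pair_op_pow_le_word) (use w B01 in \<open>auto simp: words_def B_def\<close>)
    ultimately show ?thesis using False w(1) by (simp add: words_def B_def q_def)
  qed
  have blocks: "((pair_op ^^ N) ^^ m) B x \<le> q ^ m * B x" for m x
  proof (induction m arbitrary: x)
    case (Suc m)
    have "((pair_op ^^ N) ^^ Suc m) B x \<le> (pair_op ^^ N) (\<lambda>x. 0 + q ^ m * B x) x"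
      using Suc.IH by (auto intro!: average_pow_mono)
    also have "\<dots> = q ^ m * (pair_op ^^ N) B x" by (subst average_pow_affine) simp
    also have "\<dots> \<le> q ^ m * (q * B x)" using q by (intro mult_left_mono block) auto
    finally show ?case by (simp add: mult_ac)
  qed simp
  obtain m where m: "q ^ m < \<epsilon> / 4" using real_arch_pow_inv[of "\<epsilon> / 4" q] q assms by auto
  show ?thesis
  proof (intro exI allI impI)
    fix n x assume n: "n \<ge> N * m"
    have "(pair_op ^^ n) B x \<le> (pair_op ^^ (N * m)) B x" using decr[of "n - N * m" "N * m" x] n by simp
    also have "\<dots> \<le> q ^ m * B x" using blocks[of m x] by (simp add: funpow_mult)
    also have "\<dots> \<le> \<epsilon> / 4" using m B01[of x] q mult_left_le[of "B x" "q ^ m"] by simp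
    finally have small: "(pair_op ^^ n) B x \<le> \<epsilon> / 4" .
    \<comment> \<open>The factor 2 is the chordal diameter of the sphere; it is why \<open>B\<close>
      is brought below \<epsilon>/4.\<close>
    have "dist (fst y) (snd y) \<le> \<epsilon> / 2 + 2 * B y" for y
    proof (cases "steadily_close (\<epsilon> / 2) y")
      case True
      then show ?thesis unfolding steadily_close_def by (auto dest: spec[of _ "[]"] simp: B_def)
    next
      case False
      then show ?thesis using dist_sphere_le_2[of "fst y" "snd y"] assms by (simp add: B_def)
    qed
    then have "(pair_op ^^ n) (\<lambda>x. dist (fst x) (snd x)) x \<le> (pair_op ^^ n) (\<lambda>y. \<epsilon> / 2 + 2 * B y) x"
      by (rule average_pow_mono)
    also have "\<dots> = \<epsilon> / 2 + 2 * (pair_op ^^ n) B x" by (subst average_pow_affine) simp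
    finally show "(pair_op ^^ n) (\<lambda>x. dist (fst x) (snd x)) x \<le> \<epsilon>" using small by simp
  qed
qed

end

section \<open>Measures and random words\<close>

text \<open>The truncated multiples of the distance to the complement increase to the indicator of
  an open set, and open sets form an intersection-stable generator of the Borel sets.\<close>

lemma borel_probability_eqI:
  fixes \<mu> \<nu> :: "'a::metric_space measure"
  assumes \<mu>: "borel_probability \<mu>" and \<nu>: "borel_probability \<nu>"
    and eq: "\<And>\<phi> :: 'a \<Rightarrow> real. continuous_on UNIV \<phi> \<Longrightarrow> (\<And>x. 0 \<le> \<phi> x \<and> \<phi> x \<le> 1) \<Longrightarrow>
      (\<integral>x. \<phi> x \<partial>\<mu>) = (\<integral>x. \<phi> x \<partial>\<nu>)"
  shows "\<mu> = \<nu>"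
proof -
  have lim: "(\<lambda>n. \<integral>x. min 1 (real n * infdist x (- U)) \<partial>\<rho>) \<longlonglongrightarrow> measure \<rho> U"
    if \<rho>: "borel_probability \<rho>" and U: "open U" "U \<noteq> UNIV" for \<rho> and U :: "'a set"
  proof -
    interpret prob_space \<rho> using \<rho> by (simp add: borel_probability_def)
    have sets: "sets \<rho> = sets borel" using \<rho> by (simp add: borel_probability_def)
    have "(\<lambda>x. min 1 (real n * infdist x (- U))) \<in> borel_measurable borel" for n
      by (intro borel_measurable_continuous_onI continuous_intros)
    then have meas: "(\<lambda>x. min 1 (real n * infdist x (- U))) \<in> borel_measurable \<rho>" for n
      by (simp add: measurable_cong_sets[OF sets refl])
    have ind: "indicat_real U \<in> borel_measurable \<rho>" using U(1) by (intro borel_measurable_indicator) (simp add: sets)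
    have "(\<lambda>n. min 1 (real n * infdist x (- U))) \<longlonglongrightarrow> indicat_real U x" for x
    proof (cases "x \<in> U")
      case True
      have "infdist x (- U) > 0"
        using in_closed_iff_infdist_zero[of "- U" x] U True infdist_nonneg[of x "- U"] by fastforce
      then obtain N :: nat where N: "1 \<le> N * infdist x (- U)"
        using reals_Archimedean3 less_imp_le by metis
      have "1 \<le> n * infdist x (- U)" if "n \<ge> N" for n
        using order.trans[OF N mult_right_mono[OF of_nat_mono[OF that] infdist_nonneg]] .
      then have "\<forall>\<^sub>F n in sequentially. min 1 (real n * infdist x (- U)) = 1"
        unfolding eventually_sequentially by (intro exI[of _ N]) auto
      then show ?thesis using True by (simp add: tendsto_eventually)
    qed (simp add: infdist_zero)
    then have "(\<lambda>n. \<integral>x. min 1 (real n * infdist x (- U)) \<partial>\<rho>) \<longlonglongrightarrow> (\<integral>x. indicat_real U x \<partial>\<rho>)"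
      using meas ind
      by (intro integral_dominated_convergence[where w = "\<lambda>_. 1"]) (auto simp: infdist_nonneg)
    then show ?thesis using U sets sets_eq_imp_space_eq[OF sets] by simp
  qed
  have mu: "prob_space \<mu>" "sets \<mu> = sets borel" and nu: "prob_space \<nu>" "sets \<nu> = sets borel"
    using \<mu> \<nu> by (auto simp: borel_probability_def)
  show ?thesis
  proof (rule measure_eqI_generator_eq[where E = "{U. open U}" and \<Omega> = UNIV and A = "\<lambda>_. UNIV"])
    fix U :: "'a set" assume "U \<in> {U. open U}"
    then have U: "open U" by simp
    have "measure \<mu> U = measure \<nu> U"
    \<comment> \<open>The whole space is separate because \<open>infdist\<close> to the empty set is
      0 by convention.\<close>
    proof (cases "U = UNIV")
      case True
      then show ?thesis
        using prob_space.prob_space[OF mu(1)] prob_space.prob_space[OF nu(1)]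
          sets_eq_imp_space_eq[OF mu(2)] sets_eq_imp_space_eq[OF nu(2)] by simp
    next
      case False
      have "(\<integral>x. min 1 (real n * infdist x (- U)) \<partial>\<mu>) = (\<integral>x. min 1 (real n * infdist x (- U)) \<partial>\<nu>)" for n
        by (rule eq) (auto intro!: continuous_intros simp: infdist_nonneg)
      then show ?thesis using lim[OF \<mu> U False] lim[OF \<nu> U False] by (simp add: LIMSEQ_unique)
    qed
    then show "emeasure \<mu> U = emeasure \<nu> U"
      using mu nu by (simp add: finite_measure.emeasure_eq_measure prob_space.finite_measure)
  qed (use mu nu in \<open>auto simp: Int_stable_def sets_borel borel_def prob_space.emeasure_space_1
        sets_eq_imp_space_eq finite_measure.emeasure_finite prob_space.finite_measure\<close>)
qed

lemma Cauchy_summable_dist: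
  fixes X :: "nat \<Rightarrow> 'a::metric_space"
  assumes "summable (\<lambda>n. dist (X n) (X (Suc n)))"
  shows "Cauchy X"
proof (rule metric_CauchyI)
  fix e :: real assume "e > 0"
  then obtain N where N: "\<And>m n. m \<ge> N \<Longrightarrow> norm (\<Sum>i\<in>{m..<n}. dist (X i) (X (Suc i))) < e"
    using assms unfolding summable_Cauchy by metis
  have bound: "dist (X m) (X n) \<le> (\<Sum>i\<in>{m..<n}. dist (X i) (X (Suc i)))" if "m \<le> n" for m n
    using that
  proof (induction n rule: dec_induct)
    case (step n)
    then show ?case using dist_triangle[of "X m" "X (Suc n)" "X n"] by simp
  qed simp
  have "dist (X m) (X n) < e" if "N \<le> m" "m \<le> n" for m n
    using bound[OF that(2)] N[OF that(1), of n] by simp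
  then show "\<exists>M. \<forall>m\<ge>M. \<forall>n\<ge>M. dist (X m) (X n) < e"
    by (intro exI[of _ N] allI impI) (metis dist_commute nat_le_linear)
qed

lemma words_0: "words k 0 = {[]}"
  by (auto simp: words_def)

lemma words_Suc: "words k (Suc n) = (\<lambda>(j, w). j # w) ` ({1..k} \<times> words k n)"
  by (auto simp: words_def length_Suc_conv image_iff)

text \<open>The backward measure is the image of a finite measure on words. Splitting off the first
  letter, which acts first on \<open>a\<close>, is one application of the transition
  operator.\<close>

lemma integral_backward_measure:
  fixes \<phi> :: "'a::topological_space \<Rightarrow> real"
  assumes b: "\<And>j. j \<in> {1..k} \<Longrightarrow> b j \<ge> 0" and \<phi>: "\<phi> \<in> borel_measurable borel"
  shows "(\<integral>z. \<phi> z \<partial>backward_measure k f b n a) = (transition_op k f b ^^ n) \<phi> a"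
proof -
  define M where "M = point_measure (words k n) (\<lambda>w. ennreal (prod_list (map b w)))"
  have nonneg: "prod_list (map b w) \<ge> 0" if "w \<in> words k n" for w
    using that unfolding words_def by (intro prod_list_nonneg) (auto simp: b)
  have "backward_measure k f b n a = distr M borel (\<lambda>w. backward_image f w a)"
  proof (rule measure_eqI)
    fix A assume "A \<in> sets (backward_measure k f b n a)"
    then have A: "A \<in> sets borel" by simp
    have "emeasure (distr M borel (\<lambda>w. backward_image f w a)) A
        = emeasure M ((\<lambda>w. backward_image f w a) -` A \<inter> words k n)"
      using A by (subst emeasure_distr) (auto simp: M_def space_point_measure)
    also have "\<dots> = (\<Sum>w\<in>(\<lambda>w. backward_image f w a) -` A \<inter> words k n. ennreal (prod_list (map b w)))"
      unfolding M_def by (subst emeasure_point_measure_finite) (auto simp: finite_words)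
    also have "\<dots> = (\<Sum>w\<in>words k n. ennreal (prod_list (map b w)) * indicator A (backward_image f w a))"
      by (rule sum.mono_neutral_cong_left) (auto simp: finite_words indicator_def)
    finally show "emeasure (backward_measure k f b n a) A
        = emeasure (distr M borel (\<lambda>w. backward_image f w a)) A"
      unfolding emeasure_backward_measure[OF A] using A by simp
  qed simp
  then have "(\<integral>z. \<phi> z \<partial>backward_measure k f b n a) = (\<integral>w. \<phi> (backward_image f w a) \<partial>M)"
    using \<phi> by (simp add: integral_distr M_def)
  also have "\<dots> = (\<Sum>w\<in>words k n. prod_list (map b w) * \<phi> (backward_image f w a))"
    unfolding M_def by (subst lebesgue_integral_point_measure_finite) (auto simp: finite_words nonneg)
  also have "\<dots> = (transition_op k f b ^^ n) \<phi> a"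
  proof (induction n arbitrary: a)
    case (Suc n)
    have "(\<Sum>w\<in>words k (Suc n). prod_list (map b w) * \<phi> (backward_image f w a))
        = (\<Sum>(j, w)\<in>{1..k} \<times> words k n. b j * (prod_list (map b w) * \<phi> (backward_image f w (inv (f j) a))))"
      unfolding words_Suc by (subst sum.reindex) (auto simp: inj_on_def mult_ac intro!: sum.cong)
    also have "\<dots> = (\<Sum>j=1..k. b j * (transition_op k f b ^^ n) \<phi> (inv (f j) a))"
      unfolding Suc.IH[symmetric] by (simp add: sum.cartesian_product[symmetric] sum_distrib_left)
    finally show ?case by (simp add: transition_op_def[of k f b "(transition_op k f b ^^ n) \<phi>"])
  qed (simp add: words_0)
  finally show ?thesis .
qed

section \<open>Infinite random words and the walk they drive\<close>

context probability_vector
begin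

lemma transition_op_eq_average: "transition_op k f b = average (\<lambda>j. inv (f j))"
  by (auto simp: fun_eq_iff transition_op_def average_def)

text \<open>The values of \<open>b\<close> outside \<open>{1..k}\<close> are unconstrained, so they
  are replaced by zero.\<close>

definition letter :: "nat pmf" where
  "letter = embed_pmf (\<lambda>j. if j \<in> {1..k} then b j else 0)"

definition letters :: "nat stream measure" where
  "letters = stream_space (measure_pmf letter)"

sublocale letters: prob_space letters
  unfolding letters_def by (intro prob_space.prob_space_stream_space prob_space_measure_pmf)

lemma pmf_letter: "pmf letter j = (if j \<in> {1..k} then b j else 0)"
  unfolding letter_def
proof (rule pmf_embed_pmf)
  show "0 \<le> (if j \<in> {1..k} then b j else 0)" for j using b[of j] by auto
  have "(\<integral>\<^sup>+ j. ennreal (if j \<in> {1..k} then b j else 0) \<partial>count_space UNIV)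
      = (\<Sum>j=1..k. ennreal (if j \<in> {1..k} then b j else 0))"
    by (rule nn_integral_count_space'[of "{1..k}"]) auto
  also have "\<dots> = (\<Sum>j=1..k. ennreal (b j))" by (rule sum.cong) auto
  also have "\<dots> = ennreal (\<Sum>j=1..k. b j)" using b by (intro sum_ennreal) (auto intro: less_imp_le)
  finally show "(\<integral>\<^sup>+ j. ennreal (if j \<in> {1..k} then b j else 0) \<partial>count_space UNIV) = 1"
    by (simp only: b_sum ennreal_1)
qed

lemma measurable_stake_letters [measurable]: "stake n \<in> letters \<rightarrow>\<^sub>M count_space UNIV"
proof -
  have "sets letters = sets (stream_space (count_space UNIV))"
    unfolding letters_def by (rule sets_stream_space_cong) simp
  then show ?thesis using measurable_stake measurable_cong_sets by blast
qed

lemma nn_integral_letters: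
  assumes [measurable]: "F \<in> borel_measurable letters"
  shows "(\<integral>\<^sup>+\<omega>. F \<omega> \<partial>letters) = (\<Sum>j=1..k. ennreal (b j) * (\<integral>\<^sup>+\<omega>. F (j ## \<omega>) \<partial>letters))"
proof -
  have "(\<integral>\<^sup>+\<omega>. F \<omega> \<partial>letters) = (\<integral>\<^sup>+j. (\<integral>\<^sup>+\<omega>. F (j ## \<omega>) \<partial>letters) \<partial>measure_pmf letter)"
    using assms unfolding letters_def
    by (rule prob_space.nn_integral_stream_space[OF prob_space_measure_pmf])
  also have "\<dots> = (\<Sum>j=1..k. (\<integral>\<^sup>+\<omega>. F (j ## \<omega>) \<partial>letters) * ennreal (pmf letter j))"
    by (rule nn_integral_measure_pmf_support) (auto simp: set_pmf_eq pmf_letter)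
  also have "\<dots> = (\<Sum>j=1..k. ennreal (b j) * (\<integral>\<^sup>+\<omega>. F (j ## \<omega>) \<partial>letters))"
    by (rule sum.cong) (auto simp: pmf_letter mult.commute)
  finally show ?thesis .
qed

text \<open>The first letter is applied last, in contrast to \<open>backward_image\<close>:
  lengthening the word changes only the innermost map.\<close>

definition walk :: "(nat \<Rightarrow> 'a \<Rightarrow> 'a) \<Rightarrow> 'a \<Rightarrow> nat \<Rightarrow> nat stream \<Rightarrow> 'a" where
  "walk g a n \<omega> = foldr g (stake n \<omega>) a"

lemma walk_simps [simp]: "walk g a 0 \<omega> = a" "walk g a (Suc n) (j ## \<omega>) = g j (walk g a n \<omega>)"
  by (auto simp: walk_def)

text \<open>The value depends on finitely many letters from a discrete space, so \<open>F\<close>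
  and \<open>g\<close> may be arbitrary functions.\<close>

lemma measurable_walk2 [measurable]:
  "(\<lambda>\<omega>. F (walk g a n \<omega>) (walk g a m \<omega>)) \<in> letters \<rightarrow>\<^sub>M (borel :: 'b::topological_space measure)"
proof -
  have "(\<lambda>v. F (foldr g (take n v) a) (foldr g (take m v) a)) \<circ> stake (max n m) \<in> letters \<rightarrow>\<^sub>M borel"
    by (rule measurable_comp[OF measurable_stake_letters]) simp
  then show ?thesis by (simp add: walk_def o_def take_stake min_def max_def)
qed

lemma measurable_walk [measurable]: "walk g a n \<in> letters \<rightarrow>\<^sub>M borel"
  using measurable_walk2[of "\<lambda>x y. x" g a n n] by (simp add: fun_eq_iff[symmetric])

text \<open>The first letter is independent of the rest and is the outermost map of both walks, so
  integrating it out averages over the diagonal action.\<close>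

lemma nn_integral_walk_step:
  assumes \<psi>: "\<And>x y. \<psi> (x, y) \<ge> 0"
  shows "(\<integral>\<^sup>+\<omega>. ennreal (\<psi> (walk g a (Suc n) \<omega>, walk g a (Suc m) \<omega>)) \<partial>letters)
    = (\<integral>\<^sup>+\<omega>. ennreal (average (\<lambda>j. map_prod (g j) (g j)) \<psi> (walk g a n \<omega>, walk g a m \<omega>)) \<partial>letters)"
proof -
  have meas: "(\<lambda>\<omega>. ennreal (\<psi> (F (walk g a n \<omega>), F (walk g a m \<omega>)))) \<in> borel_measurable letters" for F n m
    by (rule measurable_walk2)
  have "(\<integral>\<^sup>+\<omega>. ennreal (\<psi> (walk g a (Suc n) \<omega>, walk g a (Suc m) \<omega>)) \<partial>letters)
    = (\<Sum>j=1..k. ennreal (b j) * (\<integral>\<^sup>+\<omega>. ennreal (\<psi> (g j (walk g a n \<omega>), g j (walk g a m \<omega>))) \<partial>letters))"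
    using meas[of "\<lambda>x. x"] by (subst nn_integral_letters) auto
  also have "\<dots> = (\<integral>\<^sup>+\<omega>. (\<Sum>j=1..k. ennreal (b j) * ennreal (\<psi> (g j (walk g a n \<omega>), g j (walk g a m \<omega>)))) \<partial>letters)"
    using meas by (simp add: nn_integral_sum nn_integral_cmult)
  also have "\<dots> = (\<integral>\<^sup>+\<omega>. ennreal (average (\<lambda>j. map_prod (g j) (g j)) \<psi> (walk g a n \<omega>, walk g a m \<omega>)) \<partial>letters)"
  proof (rule nn_integral_cong)
    fix \<omega>
    have "(\<Sum>j=1..k. ennreal (b j) * ennreal (\<psi> (g j (walk g a n \<omega>), g j (walk g a m \<omega>))))
        = (\<Sum>j=1..k. ennreal (b j * \<psi> (g j (walk g a n \<omega>), g j (walk g a m \<omega>))))"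
      using b \<psi> by (intro sum.cong ennreal_mult[symmetric]) (auto intro: less_imp_le)
    also have "\<dots> = ennreal (average (\<lambda>j. map_prod (g j) (g j)) \<psi> (walk g a n \<omega>, walk g a m \<omega>))"
      unfolding average_def map_prod_simp using b \<psi>
      by (intro sum_ennreal) (auto intro!: mult_nonneg_nonneg intro: less_imp_le)
    finally show "(\<Sum>j=1..k. ennreal (b j) * ennreal (\<psi> (g j (walk g a n \<omega>), g j (walk g a m \<omega>))))
        = ennreal (average (\<lambda>j. map_prod (g j) (g j)) \<psi> (walk g a n \<omega>, walk g a m \<omega>))" .
  qed
  finally show ?thesis .
qed

lemma average_nonneg: "(\<And>x. \<psi> x \<ge> 0) \<Longrightarrow> average g \<psi> x \<ge> 0"
  unfolding average_def using b by (intro sum_nonneg mult_nonneg_nonneg) (auto intro: less_imp_le)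

text \<open>The two walks share their \<open>n\<close> outermost maps. Integrating these out leaves
  the pair of \<open>a\<close> and a walk of length \<open>l\<close>, at which the uniform bound
  \<open>C\<close> applies.\<close>

lemma nn_integral_walk_pair_le:
  assumes "\<And>x. \<psi> x \<ge> 0" "\<And>x. (average (\<lambda>j. map_prod (g j) (g j)) ^^ n) \<psi> x \<le> C"
  shows "(\<integral>\<^sup>+\<omega>. ennreal (\<psi> (walk g a n \<omega>, walk g a (n + l) \<omega>)) \<partial>letters) \<le> ennreal C"
  using assms
proof (induction n arbitrary: \<psi>)
  case 0
  have "(\<integral>\<^sup>+\<omega>. ennreal (\<psi> (walk g a 0 \<omega>, walk g a (0 + l) \<omega>)) \<partial>letters) \<le> (\<integral>\<^sup>+\<omega>. ennreal C \<partial>letters)"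
    using 0 by (intro nn_integral_mono ennreal_leI) auto
  then show ?case by (simp add: letters.emeasure_space_1)
next
  case (Suc n)
  have "(\<integral>\<^sup>+\<omega>. ennreal (average (\<lambda>j. map_prod (g j) (g j)) \<psi> (walk g a n \<omega>, walk g a (n + l) \<omega>)) \<partial>letters)
      \<le> ennreal C"
    using Suc.prems by (intro Suc.IH average_nonneg) (auto simp: funpow_swap1)
  then show ?case using nn_integral_walk_step[of \<psi> g a n "n + l"] Suc.prems(1) by simp
qed

lemma nn_integral_walk:
  assumes "\<And>x. \<psi> x \<ge> 0"
  shows "(\<integral>\<^sup>+\<omega>. ennreal (\<psi> (walk g a n \<omega>)) \<partial>letters) = ennreal ((average g ^^ n) \<psi> a)"
  using assms
proof (induction n arbitrary: \<psi>)
  case 0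
  then show ?case by (simp add: letters.emeasure_space_1)
next
  case (Suc n)
  have "average (\<lambda>j. map_prod (g j) (g j)) (\<lambda>x. \<psi> (fst x)) (x, y) = average g \<psi> x" for x y
    by (simp add: average_def)
  then have "(\<integral>\<^sup>+\<omega>. ennreal (\<psi> (walk g a (Suc n) \<omega>)) \<partial>letters)
      = (\<integral>\<^sup>+\<omega>. ennreal (average g \<psi> (walk g a n \<omega>)) \<partial>letters)"
    using nn_integral_walk_step[of "\<lambda>x. \<psi> (fst x)" g a n n] Suc.prems by simp
  also have "\<dots> = ennreal ((average g ^^ n) (average g \<psi>) a)"
    by (rule Suc.IH) (intro average_nonneg Suc.prems)
  finally show ?case by (simp add: funpow_swap1)
qed

text \<open>Adding \<open>C\<close> makes the integrand nonnegative and reduces the claim to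
  \<open>nn_integral_walk\<close>.\<close>

lemma integral_walk:
  fixes \<phi> :: "'a::topological_space \<Rightarrow> real"
  assumes C: "\<And>x. \<bar>\<phi> x\<bar> \<le> C"
  shows "(\<integral>\<omega>. \<phi> (walk g a n \<omega>) \<partial>letters) = (average g ^^ n) \<phi> a"
proof -
  have meas: "(\<lambda>\<omega>. \<phi> (walk g a n \<omega>)) \<in> borel_measurable letters"
    using measurable_walk2[of "\<lambda>x y. \<phi> x" g a n n] .
  have nonneg: "C + \<phi> x \<ge> 0" for x using C[of x] by linarith
  have int: "integrable letters (\<lambda>\<omega>. \<phi> (walk g a n \<omega>))"
    using C meas by (intro letters.integrable_const_bound[of _ C]) auto
  have "(\<integral>\<omega>. C + \<phi> (walk g a n \<omega>) \<partial>letters) = enn2real (\<integral>\<^sup>+\<omega>. ennreal (C + \<phi> (walk g a n \<omega>)) \<partial>letters)"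
    using nonneg meas by (intro integral_eq_nn_integral) auto
  also have "\<dots> = (average g ^^ n) (\<lambda>x. C + 1 * \<phi> x) a"
  proof -
    have "(average g ^^ n) (\<lambda>_. 0) a \<le> (average g ^^ n) (\<lambda>x. C + 1 * \<phi> x) a"
      using nonneg by (intro average_pow_mono) simp
    then show ?thesis
      using nn_integral_walk[of "\<lambda>x. C + 1 * \<phi> x" g a n] nonneg by (simp add: average_pow_const)
  qed
  also have "\<dots> = C + (average g ^^ n) \<phi> a" by (subst average_pow_affine) simp
  also have "(\<integral>\<omega>. C + \<phi> (walk g a n \<omega>) \<partial>letters) = C + (\<integral>\<omega>. \<phi> (walk g a n \<omega>) \<partial>letters)"
    using int by (simp add: letters.prob_space)
  finally show ?thesis by simp
qed

end

section \<open>The limit measure\<close>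

context contracting_moebius_walk
begin

lemma average_pow_pair:
  "(average (\<lambda>j. map_prod (g j) (g j)) ^^ n) (\<lambda>x. \<phi> (fst x) - \<phi> (snd x)) (x, y)
    = (average g ^^ n) \<phi> x - (average g ^^ n) \<phi> y"
  by (induction n arbitrary: x y) (simp_all add: average_def right_diff_distrib sum_subtractf)

lemma continuous_bounded:
  fixes \<phi> :: "riemann_sphere \<Rightarrow> real"
  assumes "continuous_on UNIV \<phi>"
  obtains C where "\<And>x. \<bar>\<phi> x\<bar> \<le> C"
proof -
  have "bounded (\<phi> ` UNIV)"
    by (intro compact_imp_bounded compact_continuous_image assms compact_riemann_sphere)
  then show ?thesis using that unfolding bounded_iff by auto
qed

text \<open>Uniform continuity and boundedness give a difference of values of \<phi> at most
  \<epsilon>/2 plus a multiple of the distance; the expected distance tends to zero by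
  \<open>pair_contraction\<close>.\<close>

lemma oscillation_vanishes:
  fixes \<phi> :: "riemann_sphere \<Rightarrow> real"
  assumes \<phi>: "continuous_on UNIV \<phi>" and "\<epsilon> > 0"
  obtains n0 where "\<And>n x y. n \<ge> n0 \<Longrightarrow>
    (transition_op k f b ^^ n) \<phi> x - (transition_op k f b ^^ n) \<phi> y \<le> \<epsilon>"
proof -
  obtain C where C: "\<And>x. \<bar>\<phi> x\<bar> \<le> C" using continuous_bounded[OF \<phi>] by blast
  then have C0: "C \<ge> 0" using abs_ge_zero order.trans by blast
  obtain \<delta> where \<delta>: "\<delta> > 0" "\<And>x y. dist x y < \<delta> \<Longrightarrow> dist (\<phi> x) (\<phi> y) < \<epsilon> / 2"
    using compact_uniformly_continuous[OF \<phi> compact_riemann_sphere] \<open>\<epsilon> > 0\<close>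
    unfolding uniformly_continuous_on_def by (elim allE[of _ "\<epsilon> / 2"]) auto
  define D where "D = 2 * C / \<delta>"
  have D: "D \<ge> 0" using C0 \<delta> by (simp add: D_def)
  have le: "\<phi> (fst x) - \<phi> (snd x) \<le> \<epsilon> / 2 + D * dist (fst x) (snd x)" for x
  proof (cases "dist (fst x) (snd x) < \<delta>")
    case True
    have "\<phi> (fst x) - \<phi> (snd x) < \<epsilon> / 2" using \<delta>(2)[OF True] unfolding dist_real_def by linarith
    moreover have "D * dist (fst x) (snd x) \<ge> 0" using D by simp
    ultimately show ?thesis by linarith
  next
    case False
    have "\<phi> (fst x) - \<phi> (snd x) \<le> 2 * C" using C[of "fst x"] C[of "snd x"] by linarith
    also have "\<dots> = D * \<delta>" using \<delta> by (simp add: D_def)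
    also have "\<dots> \<le> D * dist (fst x) (snd x)" using False D by (intro mult_left_mono) auto
    finally show ?thesis using assms by simp
  qed
  \<comment> \<open>The denominator has \<open>D + 1\<close> because \<open>D\<close> may be
    zero.\<close>
  have "\<epsilon> / (2 * (D + 1)) > 0" using assms D by simp
  from pair_contraction[OF this] obtain n0 where n0: "\<And>n x. n \<ge> n0 \<Longrightarrow> (pair_op ^^ n) (\<lambda>x. dist (fst x) (snd x)) x \<le> \<epsilon> / (2 * (D + 1))"
    by blast
  show ?thesis
  proof (rule that[of n0])
    fix n x y assume n: "n \<ge> n0"
    have "(transition_op k f b ^^ n) \<phi> x - (transition_op k f b ^^ n) \<phi> y
        = (pair_op ^^ n) (\<lambda>x. \<phi> (fst x) - \<phi> (snd x)) (x, y)"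
      unfolding transition_op_eq_average by (rule average_pow_pair[symmetric])
    also have "\<dots> \<le> (pair_op ^^ n) (\<lambda>x. \<epsilon> / 2 + D * dist (fst x) (snd x)) (x, y)"
      by (rule average_pow_mono[OF le])
    also have "\<dots> = \<epsilon> / 2 + D * (pair_op ^^ n) (\<lambda>x. dist (fst x) (snd x)) (x, y)"
      by (subst average_pow_affine) simp
    also have "\<dots> \<le> \<epsilon> / 2 + D * (\<epsilon> / (2 * (D + 1)))"
      using n0[OF n] D by (intro add_left_mono mult_left_mono) auto
    also have "\<dots> \<le> \<epsilon>" using D assms by (simp add: field_simps)
    finally show "(transition_op k f b ^^ n) \<phi> x - (transition_op k f b ^^ n) \<phi> y \<le> \<epsilon>" .
  qed
qed

abbreviation X :: "nat \<Rightarrow> nat stream \<Rightarrow> riemann_sphere" where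
  "X \<equiv> walk (\<lambda>j. inv (f j)) Infty"

text \<open>Composing in the order opposite to that of the backward measures does not change the law
  at a fixed time but makes the walk converge almost surely along a subsequence, so the limit measure
  is the law of an actual random point.\<close>

lemma ex_limit_measure:
  obtains \<mu> :: "riemann_sphere measure" and r where "borel_probability \<mu>" "strict_mono (r :: nat \<Rightarrow> nat)"
    "\<And>\<phi> :: riemann_sphere \<Rightarrow> real. continuous_on UNIV \<phi> \<Longrightarrow>
      (\<lambda>j. (transition_op k f b ^^ r j) \<phi> Infty) \<longlonglongrightarrow> (\<integral>z. \<phi> z \<partial>\<mu>)"
proof -
  have "\<exists>n0. \<forall>n\<ge>n0. \<forall>x. (pair_op ^^ n) (\<lambda>x. dist (fst x) (snd x)) x \<le> (1 / 2) ^ j" for j :: nat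
  proof -
    have "(1 / 2 :: real) ^ j > 0" by simp
    then show ?thesis by (rule pair_contraction)
  qed
  from choice[OF allI[OF this]] obtain N :: "nat \<Rightarrow> nat"
    where N: "\<forall>j. \<forall>n\<ge>N j. \<forall>x. (pair_op ^^ n) (\<lambda>x. dist (fst x) (snd x)) x \<le> (1 / 2) ^ j" ..
  \<comment> \<open>Partial sums of successors make \<open>r\<close> strictly increasing and at
    least \<open>N\<close>.\<close>
  define r where "r j = (\<Sum>i\<le>j. Suc (N i))" for j
  have r: "strict_mono r" by (rule strict_monoI_Suc) (simp add: r_def)
  have rN: "N j \<le> r j" for j
    using member_le_sum[of j "{..j}" "\<lambda>i. Suc (N i)"] by (simp add: r_def)
  have step: "(\<integral>\<^sup>+\<omega>. ennreal (dist (X (r j) \<omega>) (X (r (Suc j)) \<omega>)) \<partial>letters) \<le> ennreal ((1 / 2) ^ j)" for j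
  proof -
    have "r (Suc j) = r j + Suc (N (Suc j))" by (simp add: r_def)
    then show ?thesis
      using nn_integral_walk_pair_le[where \<psi> = "\<lambda>x. dist (fst x) (snd x)", OF zero_le_dist N[rule_format, OF rN]]
      by (simp only: fst_conv snd_conv)
  qed
  have meas: "(\<lambda>\<omega>. ennreal (dist (X n \<omega>) (X m \<omega>))) \<in> borel_measurable letters" for n m
    by (rule measurable_walk2)
  \<comment> \<open>The expected total length of the path along \<open>r\<close> is finite, so
    almost every path has summable steps and is Cauchy.\<close>
  have "(\<integral>\<^sup>+\<omega>. (\<Sum>j. ennreal (dist (X (r j) \<omega>) (X (r (Suc j)) \<omega>))) \<partial>letters)
      = (\<Sum>j. \<integral>\<^sup>+\<omega>. ennreal (dist (X (r j) \<omega>) (X (r (Suc j)) \<omega>)) \<partial>letters)"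
    by (rule nn_integral_suminf) (rule meas)
  also have "\<dots> \<le> (\<Sum>j. ennreal ((1 / 2) ^ j))"
    by (intro suminf_le step) auto
  also have "\<dots> = ennreal (\<Sum>j. (1 / 2) ^ j)"
    by (rule suminf_ennreal2) (auto intro: summable_geometric)
  also have "\<dots> < \<infinity>" by simp
  finally have "AE \<omega> in letters. (\<Sum>j. ennreal (dist (X (r j) \<omega>) (X (r (Suc j)) \<omega>))) \<noteq> \<infinity>"
    by (intro nn_integral_PInf_AE borel_measurable_suminf meas) auto
  then have "AE \<omega> in letters. convergent (\<lambda>j. X (r j) \<omega>)"
  proof eventually_elim
    case (elim \<omega>)
    have "summable (\<lambda>j. dist (X (r j) \<omega>) (X (r (Suc j)) \<omega>))"
      by (rule summable_suminf_not_top) (use elim in auto)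
    then have "Cauchy (\<lambda>j. X (r j) \<omega>)" by (rule Cauchy_summable_dist)
    then show ?case
      using compact_imp_complete[OF compact_riemann_sphere,
          unfolded complete_def, rule_format, of "\<lambda>j. X (r j) \<omega>"]
      by (auto simp: convergent_def)
  qed
  then obtain Z where Z: "Z \<in> null_sets letters"
    "{\<omega>\<in>space letters. \<not> convergent (\<lambda>j. X (r j) \<omega>)} \<subseteq> Z"
    unfolding eventually_ae_filter by blast
  \<comment> \<open>On the null set the walk is replaced by a constant, so the limit exists
    everywhere and is measurable.\<close>
  define Y where "Y j \<omega> = (if \<omega> \<in> Z then Infty else X (r j) \<omega>)" for j \<omega>
  define L where "L \<omega> = lim (\<lambda>j. Y j \<omega>)" for \<omega>
  have lim: "(\<lambda>j. Y j \<omega>) \<longlonglongrightarrow> L \<omega>" if "\<omega> \<in> space letters" for \<omega>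
    using that Z(2) unfolding L_def convergent_LIMSEQ_iff[symmetric]
    by (cases "\<omega> \<in> Z") (auto simp: Y_def convergent_const)
  have Zs: "Z \<in> sets letters" using Z(1) by blast
  have Y_meas: "Y j \<in> borel_measurable letters" for j
  proof -
    have "{\<omega> \<in> space letters. \<omega> \<in> Z} \<in> sets letters" using Zs by simp
    then show ?thesis unfolding Y_def[abs_def] by (intro measurable_If measurable_const measurable_walk) auto
  qed
  have L_meas: "L \<in> borel_measurable letters"
    by (rule borel_measurable_LIMSEQ_metric[OF Y_meas lim])
  define \<mu> where "\<mu> = distr letters borel L"
  show ?thesis
  proof (rule that)
    show "borel_probability \<mu>"
      unfolding borel_probability_def \<mu>_def using letters.prob_space_distr[OF L_meas] by simp
    show "strict_mono r" by (rule r)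
    fix \<phi> :: "riemann_sphere \<Rightarrow> real" assume \<phi>: "continuous_on UNIV \<phi>"
    have \<phi>_meas: "\<phi> \<in> borel_measurable borel" using \<phi> by (rule borel_measurable_continuous_onI)
    obtain C where C: "\<And>x. \<bar>\<phi> x\<bar> \<le> C" using continuous_bounded[OF \<phi>] by blast
    have "(\<lambda>j. \<integral>\<omega>. \<phi> (Y j \<omega>) \<partial>letters) \<longlonglongrightarrow> (\<integral>\<omega>. \<phi> (L \<omega>) \<partial>letters)"
    proof (rule integral_dominated_convergence[where w = "\<lambda>_. C"])
      have "isCont \<phi> z" for z using \<phi> by (simp add: continuous_on_eq_continuous_at)
      then show "AE \<omega> in letters. (\<lambda>j. \<phi> (Y j \<omega>)) \<longlonglongrightarrow> \<phi> (L \<omega>)"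
        by (intro AE_I2 isCont_tendsto_compose[OF _ lim])
    qed (use C in \<open>auto intro!: measurable_compose[OF L_meas \<phi>_meas] measurable_compose[OF Y_meas \<phi>_meas]\<close>)
    moreover have "(\<integral>\<omega>. \<phi> (Y j \<omega>) \<partial>letters) = (transition_op k f b ^^ r j) \<phi> Infty" for j
    proof -
      have "AE \<omega> in letters. \<phi> (Y j \<omega>) = \<phi> (X (r j) \<omega>)"
        using AE_not_in[OF Z(1)] by eventually_elim (simp add: Y_def)
      then have "(\<integral>\<omega>. \<phi> (Y j \<omega>) \<partial>letters) = (\<integral>\<omega>. \<phi> (X (r j) \<omega>) \<partial>letters)"
        by (intro integral_cong_AE measurable_compose[OF Y_meas \<phi>_meas] measurable_compose[OF measurable_walk \<phi>_meas])
      then show ?thesis using integral_walk[OF C] by (simp add: transition_op_eq_average)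
    qed
    ultimately show "(\<lambda>j. (transition_op k f b ^^ r j) \<phi> Infty) \<longlonglongrightarrow> (\<integral>z. \<phi> z \<partial>\<mu>)"
      unfolding \<mu>_def integral_distr[OF L_meas \<phi>_meas] by simp
  qed
qed

text \<open>Later iterates are averages of the \<open>n\<close>-th one, whose values all lie within
  \<epsilon>/2 of its value at any chosen \<open>x\<close>. Hence the limit along a subsequence at
  one point already lies within \<epsilon>/2 of every value.\<close>

lemma transition_op_pow_uniform_limit:
  fixes \<phi> :: "riemann_sphere \<Rightarrow> real"
  assumes \<phi>: "continuous_on UNIV \<phi>" and r: "strict_mono r"
    and lim: "(\<lambda>j. (transition_op k f b ^^ r j) \<phi> a) \<longlonglongrightarrow> c"
  shows "uniform_limit UNIV (\<lambda>n. (transition_op k f b ^^ n) \<phi>) (\<lambda>_. c) sequentially"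
proof (rule uniform_limitI)
  fix \<epsilon> :: real assume "\<epsilon> > 0"
  let ?T = "transition_op k f b"
  obtain n0 where n0: "\<And>n x y. n \<ge> n0 \<Longrightarrow> (?T ^^ n) \<phi> x - (?T ^^ n) \<phi> y \<le> \<epsilon> / 2"
    using oscillation_vanishes[OF \<phi>, of "\<epsilon> / 2"] \<open>\<epsilon> > 0\<close> by auto
  have "dist ((?T ^^ n) \<phi> x) c < \<epsilon>" if n: "n \<ge> n0" for n x
  proof -
    have near: "(average (\<lambda>j. inv (f j)) ^^ n) \<phi> y \<le> (average (\<lambda>j. inv (f j)) ^^ n) \<phi> x + \<epsilon> / 2 \<and>
        (average (\<lambda>j. inv (f j)) ^^ n) \<phi> x - \<epsilon> / 2 \<le> (average (\<lambda>j. inv (f j)) ^^ n) \<phi> y" for y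
      using n0[OF n, of x y] n0[OF n, of y x] unfolding transition_op_eq_average by linarith
    have later: "\<bar>(?T ^^ m) \<phi> a - (?T ^^ n) \<phi> x\<bar> \<le> \<epsilon> / 2" if "m \<ge> n" for m
    proof -
      have split: "(?T ^^ m) \<phi> = (?T ^^ (m - n)) ((?T ^^ n) \<phi>)"
        using that funpow_add[of "m - n" n ?T] by simp
      have "(?T ^^ m) \<phi> a \<le> (?T ^^ (m - n)) (\<lambda>_. (?T ^^ n) \<phi> x + \<epsilon> / 2) a"
        unfolding split unfolding transition_op_eq_average
        by (rule average_pow_mono) (rule conjunct1[OF near])
      moreover have "(?T ^^ (m - n)) (\<lambda>_. (?T ^^ n) \<phi> x - \<epsilon> / 2) a \<le> (?T ^^ m) \<phi> a"
        unfolding split unfolding transition_op_eq_average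
        by (rule average_pow_mono) (rule conjunct2[OF near])
      ultimately show ?thesis unfolding transition_op_eq_average average_pow_const by linarith
    qed
    have "\<forall>j\<ge>n. \<bar>(?T ^^ r j) \<phi> a - (?T ^^ n) \<phi> x\<bar> \<le> \<epsilon> / 2"
      using later seq_suble[OF r] order.trans by blast
    moreover have "(\<lambda>j. \<bar>(?T ^^ r j) \<phi> a - (?T ^^ n) \<phi> x\<bar>) \<longlonglongrightarrow> \<bar>c - (?T ^^ n) \<phi> x\<bar>"
      by (intro tendsto_intros lim)
    ultimately have "\<bar>c - (?T ^^ n) \<phi> x\<bar> \<le> \<epsilon> / 2"
      by (intro LIMSEQ_le_const2) auto
    then show ?thesis using \<open>\<epsilon> > 0\<close> by (simp add: dist_real_def abs_minus_commute)
  qed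
  then show "\<forall>\<^sub>F n in sequentially. \<forall>x\<in>UNIV. dist ((?T ^^ n) \<phi> x) c < \<epsilon>"
    unfolding eventually_sequentially by blast
qed

section \<open>Integrals against stationary measures\<close>

lemma continuous_transition_op:
  assumes "continuous_on UNIV \<phi>"
  shows "continuous_on UNIV (transition_op k f b \<phi>)"
  unfolding transition_op_def
  by (intro continuous_on_sum continuous_on_mult continuous_on_const
      continuous_on_compose2[OF assms] continuous_on_moebius is_moebius_inv f) auto

lemma continuous_transition_op_pow:
  "continuous_on UNIV \<phi> \<Longrightarrow> continuous_on UNIV ((transition_op k f b ^^ n) \<phi>)"
  by (induction n) (auto intro: continuous_transition_op)

lemma integral_adjoint_continuous:
  assumes "borel_probability \<rho>" "continuous_on UNIV \<phi>"
  shows "(\<integral>z. \<phi> z \<partial>adjoint_op k f b \<rho>) = (\<integral>z. transition_op k f b \<phi> z \<partial>\<rho>)"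
proof -
  obtain C where "\<And>x. \<bar>\<phi> x\<bar> \<le> C" using continuous_bounded[OF assms(2)] by blast
  then show ?thesis
    using b by (intro integral_adjoint_op f assms borel_measurable_continuous_onI) (auto intro: less_imp_le)
qed

lemma borel_probability_adjoint_op:
  assumes "borel_probability \<rho>"
  shows "borel_probability (adjoint_op k f b \<rho>)"
proof -
  have sets: "sets \<rho> = sets borel" and "prob_space \<rho>" using assms by (auto simp: borel_probability_def)
  then interpret prob_space \<rho> by simp
  have "emeasure (adjoint_op k f b \<rho>) UNIV = (\<integral>\<^sup>+z. emeasure (backward_measure k f b 1 z) UNIV \<partial>\<rho>)"
    by (intro emeasure_adjoint_op f sets) auto
  also have "\<dots> = (\<integral>\<^sup>+z. (\<Sum>j=1..k. ennreal (b j)) \<partial>\<rho>)"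
    by (subst emeasure_backward_measure_1) (simp_all only: space_in_borel indicator_UNIV mult_1_right)
  also have "(\<Sum>j=1..k. ennreal (b j)) = ennreal (\<Sum>j=1..k. b j)"
    using b by (intro sum_ennreal) (auto intro: less_imp_le)
  also have "\<dots> = 1" by (simp only: b_sum ennreal_1)
  finally show ?thesis
    unfolding borel_probability_def by (intro conjI prob_spaceI) (auto simp: emeasure_space_1)
qed

text \<open>Stationarity makes the integral of every iterate equal to that of \<phi>, while
  dominated convergence sends it to the constant \<open>c\<close>.\<close>

lemma stationary_integral_eq:
  assumes \<rho>: "borel_probability \<rho>" "adjoint_op k f b \<rho> = \<rho>" and \<phi>: "continuous_on UNIV \<phi>"
    and lim: "uniform_limit UNIV (\<lambda>n. (transition_op k f b ^^ n) \<phi>) (\<lambda>_. c) sequentially"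
  shows "(\<integral>z. \<phi> z \<partial>\<rho>) = c"
proof -
  let ?T = "transition_op k f b"
  interpret prob_space \<rho> using \<rho>(1) by (simp add: borel_probability_def)
  have sets: "sets \<rho> = sets borel" using \<rho>(1) by (simp add: borel_probability_def)
  have inv: "(\<integral>z. (?T ^^ n) \<phi> z \<partial>\<rho>) = (\<integral>z. \<phi> z \<partial>\<rho>)" for n
    by (induction n)
       (use integral_adjoint_continuous[OF \<rho>(1) continuous_transition_op_pow[OF \<phi>]] \<rho>(2) in auto)
  have meas: "(?T ^^ n) \<phi> \<in> borel_measurable \<rho>" for n
    using borel_measurable_continuous_onI[OF continuous_transition_op_pow[OF \<phi>]]
    by (simp add: measurable_cong_sets[OF sets refl])
  obtain C where C: "\<And>x. \<bar>\<phi> x\<bar> \<le> C" using continuous_bounded[OF \<phi>] by blast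
  have bound: "\<bar>(?T ^^ n) \<phi> x\<bar> \<le> C" for n x
  proof -
    have "(?T ^^ n) \<phi> x \<le> (?T ^^ n) (\<lambda>_. C) x" "(?T ^^ n) (\<lambda>_. - C) x \<le> (?T ^^ n) \<phi> x"
      unfolding transition_op_eq_average using C by (auto intro!: average_pow_mono simp: abs_le_iff minus_le_iff)
    then show ?thesis by (simp add: transition_op_eq_average average_pow_const abs_le_iff)
  qed
  have "(\<lambda>n. \<integral>z. (?T ^^ n) \<phi> z \<partial>\<rho>) \<longlonglongrightarrow> (\<integral>z. c \<partial>\<rho>)"
    using meas bound tendsto_uniform_limitI[OF lim]
    by (intro integral_dominated_convergence[where w = "\<lambda>_. C"]) auto
  then show ?thesis unfolding inv by (simp add: prob_space LIMSEQ_const_iff)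
qed

end

section \<open>The support of the limit measure\<close>

lemma closed_measure_support: "closed (measure_support \<mu>)"
proof -
  have "- measure_support \<mu> = \<Union> {U. open U \<and> emeasure \<mu> U = 0}"
    unfolding measure_support_def by (auto simp: zero_less_iff_neq_zero)
  then show ?thesis unfolding closed_def by (simp add: open_Union)
qed

text \<open>Otherwise finitely many open null sets would cover the compact sphere.\<close>

lemma measure_support_nonempty:
  fixes \<mu> :: "riemann_sphere measure"
  assumes "borel_probability \<mu>"
  shows "measure_support \<mu> \<noteq> {}"
proof
  interpret prob_space \<mu> using assms by (simp add: borel_probability_def)
  have sets: "sets \<mu> = sets borel" using assms by (simp add: borel_probability_def)
  assume empty: "measure_support \<mu> = {}"
  have "\<exists>U. open U \<and> z \<in> U \<and> emeasure \<mu> U = 0" for z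
  proof -
    have "z \<notin> measure_support \<mu>" using empty by simp
    then show ?thesis unfolding measure_support_def by (auto simp: zero_less_iff_neq_zero)
  qed
  then obtain U where U: "\<And>z. open (U z)" "\<And>z. z \<in> U z" "\<And>z. emeasure \<mu> (U z) = 0" by metis
  obtain C where C: "finite C" "UNIV \<subseteq> (\<Union>z\<in>C. U z)"
    using compactE_image[OF compact_riemann_sphere, of UNIV U] U by (metis UNIV_I UN_I subsetI)
  have "emeasure \<mu> (\<Union>z\<in>C. U z) \<le> (\<Sum>z\<in>C. emeasure \<mu> (U z))"
    using C U by (intro emeasure_subadditive_finite) (auto simp: sets)
  also have "(\<Union>z\<in>C. U z) = space \<mu>" using C sets_eq_imp_space_eq[OF sets] by auto
  finally show False using U by (simp add: emeasure_space_1)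
qed

section \<open>The two inclusions between the support and the Julia set of \<open>G\<close>\<close>

context contracting_moebius_walk
begin

abbreviation G :: "(riemann_sphere \<Rightarrow> riemann_sphere) set" where
  "G \<equiv> generated_semigroup (f ` {1..k})"

lemma G_moebius: "g \<in> G \<Longrightarrow> is_moebius g"
  by (induction rule: generated_semigroup.induct) (use f is_moebius_comp[unfolded o_def] in \<open>auto simp: o_def\<close>)

lemma inv_G: "g \<in> G \<Longrightarrow> inv g \<in> H"
  unfolding H_def inverse_semigroup_def by blast

lemma inv_H: "h \<in> H \<Longrightarrow> inv h \<in> G"
  unfolding H_def inverse_semigroup_def using bij_moebius[OF G_moebius] by (auto simp: inv_inv_eq)

text \<open>The inverses of a collapsing sequence in \<open>H\<close> lie in \<open>G\<close> and
  collapse with exceptional point \<open>p\<close>, which is therefore a Julia point of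
  \<open>G\<close>.\<close>

lemma julia_G_nonempty: "julia G \<noteq> {}"
proof -
  obtain q0 where "q0 \<in> julia H" using julia by blast
  then obtain h p q where h: "range h \<subseteq> H" "collapses (\<lambda>n. inv (h n)) q p"
    using julia_collapse[OF H_moebius _ open_UNIV UNIV_I] by metis
  then have G: "inv (h n) \<in> G" for n by (intro inv_H) auto
  then have "range (\<lambda>n. inv (h n)) \<subseteq> G" by blast
  moreover have "surj (inv (h n))" for n by (intro bij_is_surj bij_moebius G_moebius G)
  ultimately have "p \<in> julia G" using h(2) by (rule collapses_imp_julia)
  then show ?thesis by blast
qed

lemma inv_julia_G:
  assumes "j \<in> {1..k}" "z \<in> julia G"
  shows "inv (f j) z \<in> julia G"
proof (rule ccontr)
  assume "inv (f j) z \<notin> julia G"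
  then have "inv (f j) z \<in> fatou G" by (simp add: julia_def)
  moreover have "u \<circ> f j \<in> G" if "u \<in> G" for u
    using that assms(1) by (intro generated_semigroup.comp generated_semigroup.generator[of "f j"]) auto
  ultimately have "f j (inv (f j) z) \<in> fatou G"
    using fatou_image[OF f[OF assms(1)]] by blast
  then show False
    using assms by (simp add: julia_def surj_f_inv_f[OF bij_is_surj[OF bij_moebius[OF f]]])
qed

context
  fixes \<mu> :: "riemann_sphere measure"
  assumes \<mu>: "borel_probability \<mu>" and stationary: "adjoint_op k f b \<mu> = \<mu>"
begin

text \<open>By stationarity the mass of \<open>U\<close> is at least \<open>b i\<close> times the
  mass of its preimage under \<open>inv (f i)\<close>, and \<open>b i\<close> is positive.\<close>

lemma support_backward_image:
  assumes "set w \<subseteq> {1..k}" "z \<in> measure_support \<mu>"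
  shows "backward_image f w z \<in> measure_support \<mu>"
  using assms
proof (induction w arbitrary: z)
  case (Cons i w)
  have sets: "sets \<mu> = sets borel" using \<mu> by (simp add: borel_probability_def)
  have i: "i \<in> {1..k}" using Cons.prems by simp
  have "inv (f i) z \<in> measure_support \<mu>"
    unfolding measure_support_def
  proof safe
    fix U assume U: "open U" "inv (f i) z \<in> U"
    have "open (inv (f i) -` U)"
      using U(1) by (rule open_vimage) (intro continuous_on_moebius is_moebius_inv f i)
    moreover have "z \<in> inv (f i) -` U" using U(2) by simp
    ultimately have V: "open (inv (f i) -` U)" "emeasure \<mu> (inv (f i) -` U) > 0"
      using Cons.prems(2) unfolding measure_support_def by blast+
    have "0 < ennreal (b i) * emeasure \<mu> (inv (f i) -` U)"
      using V b[OF i] by (simp add: ennreal_zero_less_mult_iff)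
    also have "\<dots> = (\<integral>\<^sup>+x. ennreal (b i) * indicator (inv (f i) -` U) x \<partial>\<mu>)"
      using V by (intro nn_integral_cmult_indicator[symmetric]) (simp add: sets)
    also have "\<dots> \<le> (\<integral>\<^sup>+x. emeasure (backward_measure k f b 1 x) U \<partial>\<mu>)"
    proof (rule nn_integral_mono)
      fix x
      have "ennreal (b i) * indicator U (inv (f i) x) \<le> (\<Sum>j=1..k. ennreal (b j) * indicator U (inv (f j) x))"
        by (rule member_le_sum) (use i in auto)
      then show "ennreal (b i) * indicator (inv (f i) -` U) x \<le> emeasure (backward_measure k f b 1 x) U"
        using U(1) emeasure_backward_measure_1[of U k f b x] by (simp add: indicator_vimage)
    qed
    also have "\<dots> = emeasure (adjoint_op k f b \<mu>) U"
      using U(1) by (intro emeasure_adjoint_op[symmetric] f sets) auto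
    finally show "emeasure \<mu> U > 0" using stationary by simp
  qed
  then show ?case using Cons.IH Cons.prems(1) by simp
qed simp

text \<open>An open set meeting the Julia set of \<open>G\<close> contains a point \<open>q\<close>
  to which maps of \<open>H\<close> draw every point except \<open>p\<close>. The support is closed
  and invariant under \<open>H\<close>, so it contains \<open>q\<close> once it has a point other
  than \<open>p\<close>.\<close>

lemma julia_subset_support: "julia G \<subseteq> measure_support \<mu>"
proof
  fix a assume a: "a \<in> julia G"
  show "a \<in> measure_support \<mu>"
  proof (rule ccontr)
    assume "a \<notin> measure_support \<mu>"
    then have "a \<in> - measure_support \<mu>" by simp
    moreover have "open (- measure_support \<mu>)" by (intro open_Compl closed_measure_support)
    ultimately obtain u p q where u: "range u \<subseteq> G" "collapses (\<lambda>n. inv (u n)) q p" "q \<in> - measure_support \<mu>"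
      using julia_collapse[OF G_moebius a] by metis
    have H: "inv (u n) \<in> H" for n using u(1) by (intro inv_G) auto
    then have "range (\<lambda>n. inv (u n)) \<subseteq> H" by blast
    moreover have "surj (inv (u n))" for n by (intro bij_is_surj bij_moebius H_moebius H)
    ultimately have p: "p \<in> julia H" using u(2) by (rule collapses_imp_julia)
    have supp: "h x \<in> measure_support \<mu>" if "h \<in> H" "x \<in> measure_support \<mu>" for h x
      using that support_backward_image unfolding H_eq by blast
    obtain x0 where x0: "x0 \<in> measure_support \<mu>" using measure_support_nonempty[OF \<mu>] by blast
    obtain h where h: "h \<in> H" "h p \<in> fatou H" using ex_into_fatou by blast
    \<comment> \<open>If the chosen support point is \<open>p\<close>, its image under
      \<open>h\<close> is another support point, since \<open>p\<close> is a Julia point and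
      \<open>h p\<close> is not.\<close>
    have "h p \<noteq> p" using h p by (auto simp: julia_def)
    then obtain x where x: "x \<in> measure_support \<mu>" "x \<noteq> p"
      using x0 supp[OF h(1) x0] by (cases "x0 = p") auto
    have "q \<in> measure_support \<mu>"
      using closed_measure_support supp[OF H x(1)] collapses_tendsto[OF u(2) x(2)]
      by (rule closed_sequentially)
    then show False using u(3) by simp
  qed
qed

text \<open>A continuous function vanishing exactly on the Julia set keeps vanishing there under all
  iterates. The limit, which is its integral, is then zero, so the complement of the Julia set is
  null.\<close>

lemma support_subset_julia:
  assumes lim: "\<And>\<phi> :: riemann_sphere \<Rightarrow> real. continuous_on UNIV \<phi> \<Longrightarrow>
    uniform_limit UNIV (\<lambda>n. (transition_op k f b ^^ n) \<phi>) (\<lambda>_. \<integral>z. \<phi> z \<partial>\<mu>) sequentially"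
  shows "measure_support \<mu> \<subseteq> julia G"
proof -
  interpret prob_space \<mu> using \<mu> by (simp add: borel_probability_def)
  have sets: "sets \<mu> = sets borel" using \<mu> by (simp add: borel_probability_def)
  define \<phi> where "\<phi> x = min 1 (infdist x (julia G))" for x
  have \<phi>: "continuous_on UNIV \<phi>" unfolding \<phi>_def by (intro continuous_intros)
  have \<phi>_meas: "\<phi> \<in> borel_measurable \<mu>"
    using borel_measurable_continuous_onI[OF \<phi>] by (simp add: measurable_cong_sets[OF sets refl])
  have nonneg: "\<phi> x \<ge> 0" for x by (simp add: \<phi>_def infdist_nonneg)
  \<comment> \<open>Nonemptiness of the Julia set matters here: distances to the empty set would all
    be 0.\<close>
  have zero_iff: "\<phi> x = 0 \<longleftrightarrow> x \<in> julia G" for x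
    using in_closed_iff_infdist_zero[OF closed_julia julia_G_nonempty] by (auto simp: \<phi>_def min_def)
  obtain a where a: "a \<in> julia G" using julia_G_nonempty by blast
  have "(transition_op k f b ^^ n) \<phi> x = 0" if "x \<in> julia G" for n x
    using that
  proof (induction n arbitrary: x)
    case (Suc n)
    have "(transition_op k f b ^^ n) \<phi> (inv (f j) x) = 0" if "j \<in> {1..k}" for j
      by (intro Suc.IH inv_julia_G that Suc.prems)
    then show ?case by (simp add: transition_op_def[of k f b "(transition_op k f b ^^ n) \<phi>"])
  qed (simp add: zero_iff)
  then have "(\<lambda>n. 0) \<longlonglongrightarrow> (\<integral>z. \<phi> z \<partial>\<mu>)"
    using tendsto_uniform_limitI[OF lim[OF \<phi>] UNIV_I, of a] a by simp
  then have "(\<integral>z. \<phi> z \<partial>\<mu>) = 0" by (simp add: LIMSEQ_const_iff)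
  moreover have "integrable \<mu> \<phi>"
    using nonneg \<phi>_meas by (intro integrable_const_bound[of _ 1]) (auto simp: \<phi>_def infdist_nonneg)
  ultimately have "AE x in \<mu>. \<phi> x = 0"
    using nonneg integral_nonneg_eq_0_iff_AE by blast
  then have "AE x in \<mu>. x \<notin> - julia G" by (simp add: zero_iff)
  moreover have op: "open (- julia G)" using closed_julia by (rule open_Compl)
  ultimately have "emeasure \<mu> (- julia G) = 0"
    by (subst (asm) AE_iff_measurable[of "- julia G"]) (auto simp: sets sets_eq_imp_space_eq[OF sets])
  then show ?thesis using op unfolding measure_support_def by fastforce
qed

end

end

section \<open>The limit measure, its support and its uniqueness\<close>

theorem theorem2p2:
  fixes k :: nat
    and f :: "nat \<Rightarrow> riemann_sphere \<Rightarrow> riemann_sphere"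
    and b :: "nat \<Rightarrow> real"
    and G :: "(riemann_sphere \<Rightarrow> riemann_sphere) set"
  assumes "k \<ge> 1"
    and "\<And>j. j \<in> {1..k} \<Longrightarrow> is_moebius (f j)"
    and "G = generated_semigroup (f ` {1..k})"
    and "\<And>j. j \<in> {1..k} \<Longrightarrow> b j > 0"
    and "(\<Sum>j=1..k. b j) = 1"
    and "kernel_julia (inverse_semigroup G) = {}"
    and "julia (inverse_semigroup G) \<noteq> {}"
  shows "\<exists>\<mu> :: riemann_sphere measure.
    borel_probability \<mu> \<and>
    (\<forall>\<phi> :: riemann_sphere \<Rightarrow> real. continuous_on UNIV \<phi> \<longrightarrow>
      uniform_limit UNIV (\<lambda>n a. \<integral>z. \<phi> z \<partial>backward_measure k f b n a) (\<lambda>a. \<integral>z. \<phi> z \<partial>\<mu>) sequentially) \<and>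
    measure_support \<mu> = julia G \<and>
    adjoint_op k f b \<mu> = \<mu> \<and>
    (\<forall>\<rho>. borel_probability \<rho> \<and> adjoint_op k f b \<rho> = \<rho> \<longrightarrow> \<rho> = \<mu>)"
proof -
  interpret contracting_moebius_walk k b f "inverse_semigroup G"
    by unfold_locales (use assms in auto)
  let ?T = "transition_op k f b"
  obtain \<mu> :: "riemann_sphere measure" and r :: "nat \<Rightarrow> nat" where \<mu>: "borel_probability \<mu>" "strict_mono r"
    "\<And>\<phi> :: riemann_sphere \<Rightarrow> real. continuous_on UNIV \<phi> \<Longrightarrow> (\<lambda>j. (?T ^^ r j) \<phi> Infty) \<longlonglongrightarrow> (\<integral>z. \<phi> z \<partial>\<mu>)"
    using ex_limit_measure by blast
  have lim: "uniform_limit UNIV (\<lambda>n. (?T ^^ n) \<phi>) (\<lambda>_. \<integral>z. \<phi> z \<partial>\<mu>) sequentially"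
    if "continuous_on UNIV \<phi>" for \<phi>
    using transition_op_pow_uniform_limit[OF that \<mu>(2) \<mu>(3)[OF that]] .
  have unique: "\<rho> = \<mu>" if \<rho>: "borel_probability \<rho>" "adjoint_op k f b \<rho> = \<rho>" for \<rho>
    using stationary_integral_eq[OF \<rho> _ lim] by (intro borel_probability_eqI \<rho>(1) \<mu>(1)) auto
  have stationary: "adjoint_op k f b \<mu> = \<mu>"
  proof (rule borel_probability_eqI)
    fix \<phi> :: "riemann_sphere \<Rightarrow> real" assume \<phi>: "continuous_on UNIV \<phi>"
    have "(\<lambda>n. (?T ^^ n) \<phi> Infty) \<longlonglongrightarrow> (\<integral>z. \<phi> z \<partial>\<mu>)"
      using tendsto_uniform_limitI[OF lim[OF \<phi>]] by simp
    \<comment> \<open>Shifting the index by one exhibits the same limit as the one belonging to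
      \<open>?T \<phi>\<close>.\<close>
    then have "(\<lambda>n. (?T ^^ n) (?T \<phi>) Infty) \<longlonglongrightarrow> (\<integral>z. \<phi> z \<partial>\<mu>)"
      by (subst (asm) filterlim_sequentially_Suc[symmetric]) (simp add: funpow_swap1)
    moreover have "(\<lambda>n. (?T ^^ n) (?T \<phi>) Infty) \<longlonglongrightarrow> (\<integral>z. ?T \<phi> z \<partial>\<mu>)"
      using tendsto_uniform_limitI[OF lim[OF continuous_transition_op[OF \<phi>]]] by simp
    ultimately have "(\<integral>z. ?T \<phi> z \<partial>\<mu>) = (\<integral>z. \<phi> z \<partial>\<mu>)" by (rule LIMSEQ_unique[symmetric])
    then show "(\<integral>z. \<phi> z \<partial>adjoint_op k f b \<mu>) = (\<integral>z. \<phi> z \<partial>\<mu>)"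
      by (simp add: integral_adjoint_continuous[OF \<mu>(1) \<phi>])
  qed (use \<mu> borel_probability_adjoint_op in auto)
  have "uniform_limit UNIV (\<lambda>n a. \<integral>z. \<phi> z \<partial>backward_measure k f b n a) (\<lambda>a. \<integral>z. \<phi> z \<partial>\<mu>) sequentially"
    if \<phi>: "continuous_on UNIV \<phi>" for \<phi> :: "riemann_sphere \<Rightarrow> real"
  proof -
    have "(\<integral>z. \<phi> z \<partial>backward_measure k f b n a) = (?T ^^ n) \<phi> a" for n a
      using b \<phi> by (intro integral_backward_measure borel_measurable_continuous_onI) (auto intro: less_imp_le)
    then show ?thesis using lim[OF \<phi>] by simp
  qed
  moreover have "measure_support \<mu> = julia G"
    using support_subset_julia[OF \<mu>(1) stationary lim] julia_subset_support[OF \<mu>(1) stationary]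
    by (simp add: assms(3) subset_antisym)
  ultimately show ?thesis using \<mu>(1) stationary unique by blast
qed

end
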